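(* Let $P:\mathbb C^{\mathrm{op}}\to\mathbf{Pos}$ and $R:\mathbb D^{\mathrm{op}}\to\mathbf{Pos}$ be primary doctrines, $X$ an object of $\mathbb C$, $\varphi\in P(X)$, $(G,\mathfrak g):P\to R$ a primary 1-arrow, and $c:\mathbf t_{\mathbb D}\to G(X)$ a $\mathbb D$-arrow such that $\top\le R(c)\mathfrak g_X(\varphi)$ in $R(\mathbf t_{\mathbb D})$. Let $(G',\mathfrak g'):P_{(X,\varphi)}\to R$ be the (essentially unique) primary 1-arrow such that $(G',\mathfrak g')\circ(F_X,\mathfrak f)=(G,\mathfrak g)$ and $G'(\mathrm{id}_X)=c$. Then: (i) if $P$, $R$ and $(G,\mathfrak g)$ are elementary, then $\mathfrak g'$ preserves the fibered equality; (ii) if $P$, $R$ and $(G,\mathfrak g)$ are existential, then $\mathfrak g'$ preserves the existential quantifier; (iii) if $P$, $R$ and $(G,\mathfrak g)$ are universal, then $\mathfrak g'$ preserves the universal quantifier; (iv) if $P$, $R$ and $(G,\mathfrak g)$ are implicational, then $\mathfrak g'$ preserves the implication; (v) if $P$, $R$ are bounded, with top and bottom elements preserved by $\mathfrak g$, then $\mathfrak g'$ preserves them; (vi) if $P$, $R$ have binary joins, preserved by $\mathfrak g$, then $\mathfrak g'$ preserves binary joins; (vii) if $P$, $R$ and $(G,\mathfrak g)$ are Heyting (respectively Boolean), then $\mathfrak g'$ preserves the corresponding structure.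
   Context: A doctrine is a functor $P:\mathbb C^{\mathrm{op}}\to\mathbf{Pos}$ with $\mathbb C$ a category with finite products and $\mathbf{Pos}$ the category of posets and monotone maps; the maps $P(f)$ are called reindexings. It is primary if every $P(A)$ has finite meets ($\wedge$, $\top$) and all reindexings preserve them. A 1-arrow (doctrine homomorphism) from $P:\mathbb C^{\mathrm{op}}\to\mathbf{Pos}$ to $R:\mathbb D^{\mathrm{op}}\to\mathbf{Pos}$ is a pair $(F,\mathfrak f)$ with $F:\mathbb C\to\mathbb D$ a finite-product-preserving functor and $\mathfrak f:P\to R\circ F^{\mathrm{op}}$ natural; it is primary if $P,R$ are primary and each $\mathfrak f_A$ preserves finite meets. Composition: $(G,\mathfrak g)\circ(F,\mathfrak f)=(GF,(\mathfrak g_{FA}\mathfrak f_A)_A)$. Further structure on a doctrine $P$: - Elementary: $P$ is primary and for each object $A$ there is $\delta_A\in P(A\times A)$ (the fibered equality) with (1) $\top_A\le P(\Delta_A)(\delta_A)$; (2) $P(\mathrm{pr}_1)(\alpha)\wedge\delta_A\le P(\mathrm{pr}_2)(\alpha)$ for every $\alpha\in P(A)$; (3) $P(\langle\mathrm{pr}_1,\mathrm{pr}_3\rangle)(\delta_A)\wedge P(\langle\mathrm{pr}_2,\mathrm{pr}_4\rangle)(\delta_B)\le\delta_{A\times B}$ in $P(A\times B\times A\times B)$. - Existential: $P$ is primary and for all objects $B,C$ the map $P(\mathrm{pr}_1):P(C)\to P(C\times B)$ has a left adjoint $\exists^B_C$ with $\exists^B_CP(f\times\mathrm{id}_B)=P(f)\exists^B_{C'}$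 for every $f:C\to C'$ (Beck–Chevalley) and $\exists^B_C(\alpha\wedge P(\mathrm{pr}_1)(\beta))=\exists^B_C(\alpha)\wedge\beta$ (Frobenius). - Universal: for all $B,C$ the map $P(\mathrm{pr}_1):P(C)\to P(C\times B)$ has a right adjoint $\forall^B_C$ with $P(f)\forall^B_{C'}=\forall^B_CP(f\times\mathrm{id}_B)$ for every $f:C\to C'$. - Implicational: every $P(A)$ is a cartesian closed poset (finite meets and implication $\to$), and reindexings preserve $\wedge,\top,\to$. - Bounded: every $P(A)$ has top and bottom elements, preserved by reindexings. - Having binary joins: every $P(A)$ has binary joins, preserved by reindexings. - Heyting: every $P(A)$ is a Heyting algebra and reindexings preserve $\wedge,\top,\to,\vee,\bot$. Boolean: Heyting and $\neg(-)=(-)\to\bot:P^{\mathrm{op}}\to P$ is an isomorphism. A 1-arrow $(F,\mathfrak f):P\to R$ is elementary, existential, universal, implicational, bounded, Heyting, Boolean if $P$ and $R$ both are and $\mathfrak f$ preserves the structure (e.g. $\mathfrak f_{A\times A}(\delta_A)=\delta_{FA}$; $\mathfrak f_C\exists^B_C=\exists^{FB}_{FC}\mathfrak f_{C\times B}$; $\mathfrak f_C\forall^B_C=\forall^{FB}_{FC}\mathfrak f_{C\times B}$). Kleisli doctrine. Given a primary doctrine $P:\mathbb C^{\mathrm{op}}\to\mathbf{Pos}$, an object $X$ of $\mathbb C$ and $\varphi\in P(X)$: the category $\mathbb C_X$ has the same objects as $\mathbb C$; an arrow $g:A\rightsquigarrow B$ in $\mathbb C_X$ is a $\mathbb C$-arrow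 $g:X\times A\to B$; the identity of $A$ is $\mathrm{pr}_2:X\times A\to A$; the composite of $g:A\rightsquigarrow B$ and $h:B\rightsquigarrow C$ is $h\langle\mathrm{pr}_1,g\rangle$. It has finite products, given on objects by those of $\mathbb C$. The doctrine $P_{(X,\varphi)}:\mathbb C_X^{\mathrm{op}}\to\mathbf{Pos}$ has $P_{(X,\varphi)}(A)=\{\alpha\in P(X\times A)\mid\alpha\le P(\mathrm{pr}_1)(\varphi)\}$ with the order of $P(X\times A)$, and reindexing along $g:A\rightsquigarrow B$ is the restriction of $P(\langle\mathrm{pr}_1,g\rangle)$. The 1-arrow $(F_X,\mathfrak f):P\to P_{(X,\varphi)}$: $F_X:\mathbb C\to\mathbb C_X$ is the identity on objects and sends $f:A\to B$ to $f\,\mathrm{pr}_2:A\rightsquigarrow B$; $\mathfrak f_A(\alpha)=P(\mathrm{pr}_1)(\varphi)\wedge P(\mathrm{pr}_2)(\alpha)$, for $\mathrm{pr}_1,\mathrm{pr}_2$ the projections from $X\times A$. $P_{(X,\varphi)}$ is primary, and it inherits each of the structures listed above from $P$. Conventions: $\mathbf t$ denotes a terminal object. The arrow $\mathrm{id}_X:\mathbf t\rightsquigarrow X$ of $\mathbb C_X$ is the $\mathbb C$-arrow $\mathrm{pr}_1:X\times\mathbf t\to X$ ($X\times\mathbf t$ identified with $X$). The arrow $G'(\mathrm{id}_X)$ is regarded as having domain $\mathbf t_{\mathbb D}$ via the canonical isomorphism $G'(\mathbf t)\cong\mathbf t_{\mathbb D}$. A primary 1-arrow $(G',\mathfrak g')$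 with the properties in the claim exists and is essentially unique. *)

theory Defs
  imports "HOL-Algebra.Galois_Connection"
begin

section \<open>Categories with finite products\<close>

text \<open>The terminal object, the binary products and their projections are chosen as part of the
  data. Tupling and the maps into the terminal object are not data but are determined by the
  universal properties.\<close>

record ('o, 'a) fp_cat =
  Obj :: "'o set"
  Arr :: "'a set"
  Dom :: "'a \<Rightarrow> 'o"
  Cod :: "'a \<Rightarrow> 'o"
  Id :: "'o \<Rightarrow> 'a"
  Comp :: "'a \<Rightarrow> 'a \<Rightarrow> 'a" (infixr \<open>\<cdot>\<index>\<close> 75)
  Term :: "'o"
  Prod :: "'o \<Rightarrow> 'o \<Rightarrow> 'o" (infixr \<open>\<boxtimes>\<index>\<close> 80)
  Pr1 :: "'o \<Rightarrow> 'o \<Rightarrow> 'a"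
  Pr2 :: "'o \<Rightarrow> 'o \<Rightarrow> 'a"

definition Hom :: "('o, 'a, 'm) fp_cat_scheme \<Rightarrow> 'o \<Rightarrow> 'o \<Rightarrow> 'a set" where
  "Hom C A B = {f \<in> Arr C. Dom C f = A \<and> Cod C f = B}"

locale category =
  fixes C :: "('o, 'a, 'm) fp_cat_scheme" (structure)
  assumes Dom_Obj: "f \<in> Arr C \<Longrightarrow> Dom C f \<in> Obj C"
    and Cod_Obj: "f \<in> Arr C \<Longrightarrow> Cod C f \<in> Obj C"
    and Id_Hom: "A \<in> Obj C \<Longrightarrow> Id C A \<in> Hom C A A"
    and Comp_Hom: "\<lbrakk>f \<in> Hom C A B; g \<in> Hom C B E\<rbrakk> \<Longrightarrow> g \<cdot> f \<in> Hom C A E"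
    and Id_left: "f \<in> Hom C A B \<Longrightarrow> Id C B \<cdot> f = f"
    and Id_right: "f \<in> Hom C A B \<Longrightarrow> f \<cdot> Id C A = f"
    and Comp_assoc: "\<lbrakk>f \<in> Hom C A B; g \<in> Hom C B E; h \<in> Hom C E F\<rbrakk>
      \<Longrightarrow> (h \<cdot> g) \<cdot> f = h \<cdot> (g \<cdot> f)"

definition is_terminal :: "('o, 'a, 'm) fp_cat_scheme \<Rightarrow> 'o \<Rightarrow> bool" where
  "is_terminal C T \<longleftrightarrow> T \<in> Obj C \<and> (\<forall>A\<in>Obj C. \<exists>!f. f \<in> Hom C A T)"

definition is_product ::
  "('o, 'a, 'm) fp_cat_scheme \<Rightarrow> 'o \<Rightarrow> 'o \<Rightarrow> 'o \<Rightarrow> 'a \<Rightarrow> 'a \<Rightarrow> bool" where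
  "is_product C A B Q p q \<longleftrightarrow>
     Q \<in> Obj C \<and> p \<in> Hom C Q A \<and> q \<in> Hom C Q B \<and>
     (\<forall>Z\<in>Obj C. \<forall>f\<in>Hom C Z A. \<forall>g\<in>Hom C Z B.
        \<exists>!h. h \<in> Hom C Z Q \<and> p \<cdot>\<^bsub>C\<^esub> h = f \<and> q \<cdot>\<^bsub>C\<^esub> h = g)"

locale fp_category = category C for C :: "('o, 'a, 'm) fp_cat_scheme" (structure) +
  assumes Term_terminal: "is_terminal C (Term C)"
    and Prod_product: "\<lbrakk>A \<in> Obj C; B \<in> Obj C\<rbrakk>
      \<Longrightarrow> is_product C A B (A \<boxtimes> B) (Pr1 C A B) (Pr2 C A B)"

text \<open>The terminal object \<open>T\<close> need not be the chosen one: for a product-preserving functor \<open>F\<close>,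
  \<open>bang D (Term D) (F (Term C))\<close> is the canonical isomorphism onto \<open>F (Term C)\<close>. Likewise \<open>mediate\<close>
  below applies to an arbitrary product cone \<open>(Q, p, q)\<close>.\<close>

definition bang :: "('o, 'a, 'm) fp_cat_scheme \<Rightarrow> 'o \<Rightarrow> 'o \<Rightarrow> 'a" where
  "bang C A T = (THE f. f \<in> Hom C A T)"

definition mediate ::
  "('o, 'a, 'm) fp_cat_scheme \<Rightarrow> 'o \<Rightarrow> 'a \<Rightarrow> 'a \<Rightarrow> 'a \<Rightarrow> 'a \<Rightarrow> 'a" where
  "mediate C Q p q f g =
     (THE h. h \<in> Hom C (Dom C f) Q \<and> p \<cdot>\<^bsub>C\<^esub> h = f \<and> q \<cdot>\<^bsub>C\<^esub> h = g)"

definition tuple :: "('o, 'a, 'm) fp_cat_scheme \<Rightarrow> 'a \<Rightarrow> 'a \<Rightarrow> 'a"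
    (\<open>\<langle>_,/ _\<rangle>\<index>\<close>) where
  "\<langle>f, g\<rangle>\<^bsub>C\<^esub> = mediate C (Cod C f \<boxtimes>\<^bsub>C\<^esub> Cod C g)
     (Pr1 C (Cod C f) (Cod C g)) (Pr2 C (Cod C f) (Cod C g)) f g"

definition times_id :: "('o, 'a, 'm) fp_cat_scheme \<Rightarrow> 'a \<Rightarrow> 'o \<Rightarrow> 'a" where
  "times_id C f B = \<langle>f \<cdot>\<^bsub>C\<^esub> Pr1 C (Dom C f) B, Pr2 C (Dom C f) B\<rangle>\<^bsub>C\<^esub>"


section \<open>Doctrines\<close>

text \<open>A doctrine carries its base category; \<open>Fib P A\<close> is the poset \<open>P(A)\<close> and \<open>Reidx P f\<close> is the
  reindexing \<open>P(f)\<close>.\<close>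

record ('o, 'a, 'p) doctrine = "('o, 'a) fp_cat" +
  Fib :: "'o \<Rightarrow> 'p gorder"
  Reidx :: "'a \<Rightarrow> 'p \<Rightarrow> 'p"

locale doctrine = fp_category P for P :: "('o, 'a, 'p) doctrine" (structure) +
  assumes Fib_po: "A \<in> Obj P \<Longrightarrow> partial_order (Fib P A)"
    and Reidx_closed: "f \<in> Hom P A B \<Longrightarrow> Reidx P f \<in> carrier (Fib P B) \<rightarrow> carrier (Fib P A)"
    and Reidx_mono: "f \<in> Hom P A B \<Longrightarrow> isotone (Fib P B) (Fib P A) (Reidx P f)"
    and Reidx_Id: "\<lbrakk>A \<in> Obj P; \<alpha> \<in> carrier (Fib P A)\<rbrakk> \<Longrightarrow> Reidx P (Id P A) \<alpha> = \<alpha>"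
    and Reidx_Comp: "\<lbrakk>f \<in> Hom P A B; g \<in> Hom P B E; \<alpha> \<in> carrier (Fib P E)\<rbrakk>
      \<Longrightarrow> Reidx P (g \<cdot> f) \<alpha> = Reidx P f (Reidx P g \<alpha>)"

definition meet_poset :: "'p gorder \<Rightarrow> bool" where
  "meet_poset L \<longleftrightarrow> lower_semilattice L \<and> weak_partial_order_top L"

definition preserves_top :: "'p gorder \<Rightarrow> 'q gorder \<Rightarrow> ('p \<Rightarrow> 'q) \<Rightarrow> bool" where
  "preserves_top L M k \<longleftrightarrow> k \<top>\<^bsub>L\<^esub> = \<top>\<^bsub>M\<^esub>"

definition preserves_bottom :: "'p gorder \<Rightarrow> 'q gorder \<Rightarrow> ('p \<Rightarrow> 'q) \<Rightarrow> bool" where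
  "preserves_bottom L M k \<longleftrightarrow> k \<bottom>\<^bsub>L\<^esub> = \<bottom>\<^bsub>M\<^esub>"

definition preserves_meet :: "'p gorder \<Rightarrow> 'q gorder \<Rightarrow> ('p \<Rightarrow> 'q) \<Rightarrow> bool" where
  "preserves_meet L M k \<longleftrightarrow>
     (\<forall>x\<in>carrier L. \<forall>y\<in>carrier L. k (x \<sqinter>\<^bsub>L\<^esub> y) = k x \<sqinter>\<^bsub>M\<^esub> k y)"

definition preserves_join :: "'p gorder \<Rightarrow> 'q gorder \<Rightarrow> ('p \<Rightarrow> 'q) \<Rightarrow> bool" where
  "preserves_join L M k \<longleftrightarrow>
     (\<forall>x\<in>carrier L. \<forall>y\<in>carrier L. k (x \<squnion>\<^bsub>L\<^esub> y) = k x \<squnion>\<^bsub>M\<^esub> k y)"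

definition is_imp :: "'p gorder \<Rightarrow> 'p \<Rightarrow> 'p \<Rightarrow> 'p \<Rightarrow> bool" where
  "is_imp L a b c \<longleftrightarrow>
     c \<in> carrier L \<and> (\<forall>x\<in>carrier L. x \<sqsubseteq>\<^bsub>L\<^esub> c \<longleftrightarrow> x \<sqinter>\<^bsub>L\<^esub> a \<sqsubseteq>\<^bsub>L\<^esub> b)"

definition imp :: "'p gorder \<Rightarrow> 'p \<Rightarrow> 'p \<Rightarrow> 'p" where
  "imp L a b = (THE c. is_imp L a b c)"

definition neg :: "'p gorder \<Rightarrow> 'p \<Rightarrow> 'p" where
  "neg L a = imp L a \<bottom>\<^bsub>L\<^esub>"

definition preserves_imp :: "'p gorder \<Rightarrow> 'q gorder \<Rightarrow> ('p \<Rightarrow> 'q) \<Rightarrow> bool" where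
  "preserves_imp L M k \<longleftrightarrow>
     (\<forall>x\<in>carrier L. \<forall>y\<in>carrier L. k (imp L x y) = imp M (k x) (k y))"

definition cartesian_closed_poset :: "'p gorder \<Rightarrow> bool" where
  "cartesian_closed_poset L \<longleftrightarrow>
     meet_poset L \<and> (\<forall>a\<in>carrier L. \<forall>b\<in>carrier L. \<exists>c. is_imp L a b c)"

definition heyting_algebra :: "'p gorder \<Rightarrow> bool" where
  "heyting_algebra L \<longleftrightarrow> bounded_lattice L \<and> cartesian_closed_poset L"

definition primary :: "('o, 'a, 'p) doctrine \<Rightarrow> bool" where
  "primary P \<longleftrightarrow> doctrine P \<and> (\<forall>A\<in>Obj P. meet_poset (Fib P A)) \<and>
     (\<forall>A B. \<forall>f\<in>Hom P A B. preserves_top (Fib P B) (Fib P A) (Reidx P f) \<and>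
        preserves_meet (Fib P B) (Fib P A) (Reidx P f))"


section \<open>Further structure on doctrines\<close>

text \<open>The product \<open>A \<times> B \<times> A \<times> B\<close> is formed as \<open>(A \<times> B) \<times> (A \<times> B)\<close>, in whose fiber the
  equality of \<open>A \<times> B\<close> lives; its four projections are the composites below.\<close>

definition fibered_equality :: "('o, 'a, 'p) doctrine \<Rightarrow> ('o \<Rightarrow> 'p) \<Rightarrow> bool" where
  "fibered_equality P \<delta> \<longleftrightarrow>
     (\<forall>A\<in>Obj P. \<delta> A \<in> carrier (Fib P (A \<boxtimes>\<^bsub>P\<^esub> A))) \<and>
     (\<forall>A\<in>Obj P. \<top>\<^bsub>Fib P A\<^esub> \<sqsubseteq>\<^bsub>Fib P A\<^esub> Reidx P \<langle>Id P A, Id P A\<rangle>\<^bsub>P\<^esub> (\<delta> A)) \<and>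
     (\<forall>A\<in>Obj P. \<forall>\<alpha>\<in>carrier (Fib P A).
        Reidx P (Pr1 P A A) \<alpha> \<sqinter>\<^bsub>Fib P (A \<boxtimes>\<^bsub>P\<^esub> A)\<^esub> \<delta> A
          \<sqsubseteq>\<^bsub>Fib P (A \<boxtimes>\<^bsub>P\<^esub> A)\<^esub> Reidx P (Pr2 P A A) \<alpha>) \<and>
     (\<forall>A\<in>Obj P. \<forall>B\<in>Obj P.
        (let Q = A \<boxtimes>\<^bsub>P\<^esub> B;
             p1 = Pr1 P A B \<cdot>\<^bsub>P\<^esub> Pr1 P Q Q; p2 = Pr2 P A B \<cdot>\<^bsub>P\<^esub> Pr1 P Q Q;
             p3 = Pr1 P A B \<cdot>\<^bsub>P\<^esub> Pr2 P Q Q; p4 = Pr2 P A B \<cdot>\<^bsub>P\<^esub> Pr2 P Q Q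
         in Reidx P \<langle>p1, p3\<rangle>\<^bsub>P\<^esub> (\<delta> A) \<sqinter>\<^bsub>Fib P (Q \<boxtimes>\<^bsub>P\<^esub> Q)\<^esub> Reidx P \<langle>p2, p4\<rangle>\<^bsub>P\<^esub> (\<delta> B)
              \<sqsubseteq>\<^bsub>Fib P (Q \<boxtimes>\<^bsub>P\<^esub> Q)\<^esub> \<delta> Q))"

definition elementary :: "('o, 'a, 'p) doctrine \<Rightarrow> bool" where
  "elementary P \<longleftrightarrow> primary P \<and> (\<exists>\<delta>. fibered_equality P \<delta>)"

text \<open>In \<open>E B C\<close> below, \<open>B\<close> is the quantified object (upper index) and \<open>C\<close> the context
  (lower index).\<close>

definition existential_quantifier ::
  "('o, 'a, 'p) doctrine \<Rightarrow> ('o \<Rightarrow> 'o \<Rightarrow> 'p \<Rightarrow> 'p) \<Rightarrow> bool" where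
  "existential_quantifier P E \<longleftrightarrow>
     (\<forall>B\<in>Obj P. \<forall>C\<in>Obj P. galois_connection
        \<lparr>orderA = Fib P (C \<boxtimes>\<^bsub>P\<^esub> B), orderB = Fib P C, lower = E B C, upper = Reidx P (Pr1 P C B)\<rparr>) \<and>
     (\<forall>B\<in>Obj P. \<forall>C C'. \<forall>f\<in>Hom P C C'. \<forall>\<alpha>\<in>carrier (Fib P (C' \<boxtimes>\<^bsub>P\<^esub> B)).
        E B C (Reidx P (times_id P f B) \<alpha>) = Reidx P f (E B C' \<alpha>)) \<and>
     (\<forall>B\<in>Obj P. \<forall>C\<in>Obj P. \<forall>\<alpha>\<in>carrier (Fib P (C \<boxtimes>\<^bsub>P\<^esub> B)). \<forall>\<beta>\<in>carrier (Fib P C).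
        E B C (\<alpha> \<sqinter>\<^bsub>Fib P (C \<boxtimes>\<^bsub>P\<^esub> B)\<^esub> Reidx P (Pr1 P C B) \<beta>) = E B C \<alpha> \<sqinter>\<^bsub>Fib P C\<^esub> \<beta>)"

definition existential :: "('o, 'a, 'p) doctrine \<Rightarrow> bool" where
  "existential P \<longleftrightarrow> primary P \<and> (\<exists>E. existential_quantifier P E)"

definition universal_quantifier ::
  "('o, 'a, 'p) doctrine \<Rightarrow> ('o \<Rightarrow> 'o \<Rightarrow> 'p \<Rightarrow> 'p) \<Rightarrow> bool" where
  "universal_quantifier P U \<longleftrightarrow>
     (\<forall>B\<in>Obj P. \<forall>C\<in>Obj P. galois_connection
        \<lparr>orderA = Fib P C, orderB = Fib P (C \<boxtimes>\<^bsub>P\<^esub> B), lower = Reidx P (Pr1 P C B), upper = U B C\<rparr>) \<and>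
     (\<forall>B\<in>Obj P. \<forall>C C'. \<forall>f\<in>Hom P C C'. \<forall>\<alpha>\<in>carrier (Fib P (C' \<boxtimes>\<^bsub>P\<^esub> B)).
        Reidx P f (U B C' \<alpha>) = U B C (Reidx P (times_id P f B) \<alpha>))"

definition universal :: "('o, 'a, 'p) doctrine \<Rightarrow> bool" where
  "universal P \<longleftrightarrow> doctrine P \<and> (\<exists>U. universal_quantifier P U)"

definition implicational :: "('o, 'a, 'p) doctrine \<Rightarrow> bool" where
  "implicational P \<longleftrightarrow> primary P \<and> (\<forall>A\<in>Obj P. cartesian_closed_poset (Fib P A)) \<and>
     (\<forall>A B. \<forall>f\<in>Hom P A B. preserves_imp (Fib P B) (Fib P A) (Reidx P f))"

definition bounded_doctrine :: "('o, 'a, 'p) doctrine \<Rightarrow> bool" where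
  "bounded_doctrine P \<longleftrightarrow> doctrine P \<and>
     (\<forall>A\<in>Obj P. weak_partial_order_top (Fib P A) \<and> weak_partial_order_bottom (Fib P A)) \<and>
     (\<forall>A B. \<forall>f\<in>Hom P A B. preserves_top (Fib P B) (Fib P A) (Reidx P f) \<and>
        preserves_bottom (Fib P B) (Fib P A) (Reidx P f))"

definition has_binary_joins :: "('o, 'a, 'p) doctrine \<Rightarrow> bool" where
  "has_binary_joins P \<longleftrightarrow> doctrine P \<and> (\<forall>A\<in>Obj P. upper_semilattice (Fib P A)) \<and>
     (\<forall>A B. \<forall>f\<in>Hom P A B. preserves_join (Fib P B) (Fib P A) (Reidx P f))"

definition heyting :: "('o, 'a, 'p) doctrine \<Rightarrow> bool" where
  "heyting P \<longleftrightarrow> doctrine P \<and> (\<forall>A\<in>Obj P. heyting_algebra (Fib P A)) \<and>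
     (\<forall>A B. \<forall>f\<in>Hom P A B.
        preserves_meet (Fib P B) (Fib P A) (Reidx P f) \<and> preserves_top (Fib P B) (Fib P A) (Reidx P f) \<and>
        preserves_imp (Fib P B) (Fib P A) (Reidx P f) \<and> preserves_join (Fib P B) (Fib P A) (Reidx P f) \<and>
        preserves_bottom (Fib P B) (Fib P A) (Reidx P f))"

text \<open>Negation commutes with reindexing in every Heyting doctrine, so it is an isomorphism from
  \<open>P\<close> with reversed fibers to \<open>P\<close> iff each of its components is an isomorphism of posets.\<close>

definition boolean :: "('o, 'a, 'p) doctrine \<Rightarrow> bool" where
  "boolean P \<longleftrightarrow> heyting P \<and> (\<forall>A\<in>Obj P.
     bij_betw (neg (Fib P A)) (carrier (Fib P A)) (carrier (Fib P A)) \<and>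
     order_emb (inv_gorder (Fib P A)) (Fib P A) (neg (Fib P A)))"


section \<open>1-arrows\<close>

record ('o, 'a, 'p, 'u, 'b, 'q) arrow1 =
  ob :: "'o \<Rightarrow> 'u"
  ar :: "'a \<Rightarrow> 'b"
  fib :: "'o \<Rightarrow> 'p \<Rightarrow> 'q"

definition fp_functor ::
  "('o, 'a, 'm) fp_cat_scheme \<Rightarrow> ('u, 'b, 'n) fp_cat_scheme \<Rightarrow> ('o \<Rightarrow> 'u) \<Rightarrow> ('a \<Rightarrow> 'b) \<Rightarrow> bool"
  where
  "fp_functor C D Fo Fa \<longleftrightarrow>
     (\<forall>A\<in>Obj C. Fo A \<in> Obj D) \<and>
     (\<forall>A B. \<forall>f\<in>Hom C A B. Fa f \<in> Hom D (Fo A) (Fo B)) \<and>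
     (\<forall>A\<in>Obj C. Fa (Id C A) = Id D (Fo A)) \<and>
     (\<forall>A B E. \<forall>f\<in>Hom C A B. \<forall>g\<in>Hom C B E. Fa (g \<cdot>\<^bsub>C\<^esub> f) = Fa g \<cdot>\<^bsub>D\<^esub> Fa f) \<and>
     is_terminal D (Fo (Term C)) \<and>
     (\<forall>A\<in>Obj C. \<forall>B\<in>Obj C.
        is_product D (Fo A) (Fo B) (Fo (A \<boxtimes>\<^bsub>C\<^esub> B)) (Fa (Pr1 C A B)) (Fa (Pr2 C A B)))"

definition is_arrow1 ::
  "('o, 'a, 'p) doctrine \<Rightarrow> ('u, 'b, 'q) doctrine \<Rightarrow> ('o, 'a, 'p, 'u, 'b, 'q) arrow1 \<Rightarrow> bool" where
  "is_arrow1 P R M \<longleftrightarrow> doctrine P \<and> doctrine R \<and> fp_functor P R (ob M) (ar M) \<and>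
     (\<forall>A\<in>Obj P. fib M A \<in> carrier (Fib P A) \<rightarrow> carrier (Fib R (ob M A)) \<and>
        isotone (Fib P A) (Fib R (ob M A)) (fib M A)) \<and>
     (\<forall>A B. \<forall>f\<in>Hom P A B. \<forall>\<alpha>\<in>carrier (Fib P B).
        fib M A (Reidx P f \<alpha>) = Reidx R (ar M f) (fib M B \<alpha>))"

definition comp_arrow1 ::
  "('u, 'b, 'q, 'v, 'c, 'r) arrow1 \<Rightarrow> ('o, 'a, 'p, 'u, 'b, 'q) arrow1
    \<Rightarrow> ('o, 'a, 'p, 'v, 'c, 'r) arrow1" where
  "comp_arrow1 N M =
     \<lparr>ob = ob N \<circ> ob M, ar = ar N \<circ> ar M, fib = (\<lambda>A. fib N (ob M A) \<circ> fib M A)\<rparr>"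

text \<open>Equality of 1-arrows out of \<open>P\<close>: values outside the carriers are irrelevant.\<close>

definition eq_arrow1 ::
  "('o, 'a, 'p) doctrine \<Rightarrow> ('o, 'a, 'p, 'u, 'b, 'q) arrow1
    \<Rightarrow> ('o, 'a, 'p, 'u, 'b, 'q) arrow1 \<Rightarrow> bool" where
  "eq_arrow1 P M N \<longleftrightarrow>
     (\<forall>A\<in>Obj P. ob M A = ob N A) \<and> (\<forall>f\<in>Arr P. ar M f = ar N f) \<and>
     (\<forall>A\<in>Obj P. \<forall>\<alpha>\<in>carrier (Fib P A). fib M A \<alpha> = fib N A \<alpha>)"

definition primary_arrow ::
  "('o, 'a, 'p) doctrine \<Rightarrow> ('u, 'b, 'q) doctrine \<Rightarrow> ('o, 'a, 'p, 'u, 'b, 'q) arrow1 \<Rightarrow> bool" where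
  "primary_arrow P R M \<longleftrightarrow> primary P \<and> primary R \<and> is_arrow1 P R M \<and>
     (\<forall>A\<in>Obj P. preserves_top (Fib P A) (Fib R (ob M A)) (fib M A) \<and>
        preserves_meet (Fib P A) (Fib R (ob M A)) (fib M A))"

text \<open>A product-preserving functor \<open>F\<close> need not preserve the chosen products strictly.
  \<open>prod_iso P R M A B\<close> is the canonical isomorphism \<open>FA \<times> FB \<rightarrow> F(A \<times> B)\<close>; reindexing along it
  identifies \<open>R(F(A \<times> B))\<close> with \<open>R(FA \<times> FB)\<close>. This identification is left implicit in the usual
  preservation equations for equality and quantifiers.\<close>

definition prod_iso ::
  "('o, 'a, 'p) doctrine \<Rightarrow> ('u, 'b, 'q) doctrine \<Rightarrow> ('o, 'a, 'p, 'u, 'b, 'q) arrow1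
    \<Rightarrow> 'o \<Rightarrow> 'o \<Rightarrow> 'b" where
  "prod_iso P R M A B = mediate R (ob M (A \<boxtimes>\<^bsub>P\<^esub> B)) (ar M (Pr1 P A B)) (ar M (Pr2 P A B))
     (Pr1 R (ob M A) (ob M B)) (Pr2 R (ob M A) (ob M B))"

text \<open>Fibered equalities and quantifiers are unique on the relevant fibers when they exist; hence
  quantifying over all of them below refers to ``the'' one of each doctrine.\<close>

definition elementary_arrow ::
  "('o, 'a, 'p) doctrine \<Rightarrow> ('u, 'b, 'q) doctrine \<Rightarrow> ('o, 'a, 'p, 'u, 'b, 'q) arrow1 \<Rightarrow> bool" where
  "elementary_arrow P R M \<longleftrightarrow> elementary P \<and> elementary R \<and> is_arrow1 P R M \<and>
     (\<forall>\<delta> \<epsilon>. fibered_equality P \<delta> \<longrightarrow> fibered_equality R \<epsilon> \<longrightarrow>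
        (\<forall>A\<in>Obj P. Reidx R (prod_iso P R M A A) (fib M (A \<boxtimes>\<^bsub>P\<^esub> A) (\<delta> A)) = \<epsilon> (ob M A)))"

definition existential_arrow ::
  "('o, 'a, 'p) doctrine \<Rightarrow> ('u, 'b, 'q) doctrine \<Rightarrow> ('o, 'a, 'p, 'u, 'b, 'q) arrow1 \<Rightarrow> bool" where
  "existential_arrow P R M \<longleftrightarrow> existential P \<and> existential R \<and> is_arrow1 P R M \<and>
     (\<forall>E E'. existential_quantifier P E \<longrightarrow> existential_quantifier R E' \<longrightarrow>
        (\<forall>B\<in>Obj P. \<forall>C\<in>Obj P. \<forall>\<alpha>\<in>carrier (Fib P (C \<boxtimes>\<^bsub>P\<^esub> B)).
           fib M C (E B C \<alpha>)
             = E' (ob M B) (ob M C) (Reidx R (prod_iso P R M C B) (fib M (C \<boxtimes>\<^bsub>P\<^esub> B) \<alpha>))))"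

definition universal_arrow ::
  "('o, 'a, 'p) doctrine \<Rightarrow> ('u, 'b, 'q) doctrine \<Rightarrow> ('o, 'a, 'p, 'u, 'b, 'q) arrow1 \<Rightarrow> bool" where
  "universal_arrow P R M \<longleftrightarrow> universal P \<and> universal R \<and> is_arrow1 P R M \<and>
     (\<forall>U U'. universal_quantifier P U \<longrightarrow> universal_quantifier R U' \<longrightarrow>
        (\<forall>B\<in>Obj P. \<forall>C\<in>Obj P. \<forall>\<alpha>\<in>carrier (Fib P (C \<boxtimes>\<^bsub>P\<^esub> B)).
           fib M C (U B C \<alpha>)
             = U' (ob M B) (ob M C) (Reidx R (prod_iso P R M C B) (fib M (C \<boxtimes>\<^bsub>P\<^esub> B) \<alpha>))))"

definition implicational_arrow ::
  "('o, 'a, 'p) doctrine \<Rightarrow> ('u, 'b, 'q) doctrine \<Rightarrow> ('o, 'a, 'p, 'u, 'b, 'q) arrow1 \<Rightarrow> bool" where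
  "implicational_arrow P R M \<longleftrightarrow> implicational P \<and> implicational R \<and> primary_arrow P R M \<and>
     (\<forall>A\<in>Obj P. preserves_imp (Fib P A) (Fib R (ob M A)) (fib M A))"

definition bounded_arrow ::
  "('o, 'a, 'p) doctrine \<Rightarrow> ('u, 'b, 'q) doctrine \<Rightarrow> ('o, 'a, 'p, 'u, 'b, 'q) arrow1 \<Rightarrow> bool" where
  "bounded_arrow P R M \<longleftrightarrow> bounded_doctrine P \<and> bounded_doctrine R \<and> is_arrow1 P R M \<and>
     (\<forall>A\<in>Obj P. preserves_top (Fib P A) (Fib R (ob M A)) (fib M A) \<and>
        preserves_bottom (Fib P A) (Fib R (ob M A)) (fib M A))"

definition join_arrow ::
  "('o, 'a, 'p) doctrine \<Rightarrow> ('u, 'b, 'q) doctrine \<Rightarrow> ('o, 'a, 'p, 'u, 'b, 'q) arrow1 \<Rightarrow> bool" where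
  "join_arrow P R M \<longleftrightarrow> has_binary_joins P \<and> has_binary_joins R \<and> is_arrow1 P R M \<and>
     (\<forall>A\<in>Obj P. preserves_join (Fib P A) (Fib R (ob M A)) (fib M A))"

definition heyting_arrow ::
  "('o, 'a, 'p) doctrine \<Rightarrow> ('u, 'b, 'q) doctrine \<Rightarrow> ('o, 'a, 'p, 'u, 'b, 'q) arrow1 \<Rightarrow> bool" where
  "heyting_arrow P R M \<longleftrightarrow> heyting P \<and> heyting R \<and> is_arrow1 P R M \<and>
     (\<forall>A\<in>Obj P.
        preserves_meet (Fib P A) (Fib R (ob M A)) (fib M A) \<and>
        preserves_top (Fib P A) (Fib R (ob M A)) (fib M A) \<and>
        preserves_imp (Fib P A) (Fib R (ob M A)) (fib M A) \<and>
        preserves_join (Fib P A) (Fib R (ob M A)) (fib M A) \<and>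
        preserves_bottom (Fib P A) (Fib R (ob M A)) (fib M A))"

definition boolean_arrow ::
  "('o, 'a, 'p) doctrine \<Rightarrow> ('u, 'b, 'q) doctrine \<Rightarrow> ('o, 'a, 'p, 'u, 'b, 'q) arrow1 \<Rightarrow> bool" where
  "boolean_arrow P R M \<longleftrightarrow> boolean P \<and> boolean R \<and> heyting_arrow P R M"


section \<open>The Kleisli doctrine\<close>

text \<open>An arrow \<open>g : A \<leadsto> B\<close> is encoded as the triple \<open>(A, g, B)\<close>, because \<open>g : X \<times> A \<rightarrow> B\<close> alone
  does not determine \<open>A\<close>. The projections are the images under \<open>F\<^sub>X\<close> of those of the base.\<close>

definition kleisli_cat ::
  "('o, 'a, 'm) fp_cat_scheme \<Rightarrow> 'o \<Rightarrow> ('o, 'o \<times> 'a \<times> 'o) fp_cat" where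
  "kleisli_cat C X = \<lparr>
     Obj = Obj C,
     Arr = {(A, g, B). A \<in> Obj C \<and> B \<in> Obj C \<and> g \<in> Hom C (X \<boxtimes>\<^bsub>C\<^esub> A) B},
     Dom = (\<lambda>(A, g, B). A),
     Cod = (\<lambda>(A, g, B). B),
     Id = (\<lambda>A. (A, Pr2 C X A, A)),
     Comp = (\<lambda>(_, h, E) (A, g, _). (A, h \<cdot>\<^bsub>C\<^esub> \<langle>Pr1 C X A, g\<rangle>\<^bsub>C\<^esub>, E)),
     Term = Term C,
     Prod = Prod C,
     Pr1 = (\<lambda>A B. (A \<boxtimes>\<^bsub>C\<^esub> B, Pr1 C A B \<cdot>\<^bsub>C\<^esub> Pr2 C X (A \<boxtimes>\<^bsub>C\<^esub> B), A)),
     Pr2 = (\<lambda>A B. (A \<boxtimes>\<^bsub>C\<^esub> B, Pr2 C A B \<cdot>\<^bsub>C\<^esub> Pr2 C X (A \<boxtimes>\<^bsub>C\<^esub> B), B))\<rparr>"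

definition kleisli_doctrine ::
  "('o, 'a, 'p) doctrine \<Rightarrow> 'o \<Rightarrow> 'p \<Rightarrow> ('o, 'o \<times> 'a \<times> 'o, 'p) doctrine" where
  "kleisli_doctrine P X \<phi> = fp_cat.extend (kleisli_cat P X) (doctrine.fields
     (\<lambda>A. (Fib P (X \<boxtimes>\<^bsub>P\<^esub> A))\<lparr>carrier := {\<alpha> \<in> carrier (Fib P (X \<boxtimes>\<^bsub>P\<^esub> A)).
             \<alpha> \<sqsubseteq>\<^bsub>Fib P (X \<boxtimes>\<^bsub>P\<^esub> A)\<^esub> Reidx P (Pr1 P X A) \<phi>}\<rparr>)
     (\<lambda>(A, g, B). Reidx P \<langle>Pr1 P X A, g\<rangle>\<^bsub>P\<^esub>))"

text \<open>The 1-arrow \<open>(F\<^sub>X, \<ff>) : P \<rightarrow> P\<^sub>(\<^sub>X\<^sub>,\<^sub>\<phi>\<^sub>)\<close>.\<close>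

definition kleisli_arrow ::
  "('o, 'a, 'p) doctrine \<Rightarrow> 'o \<Rightarrow> 'p \<Rightarrow> ('o, 'a, 'p, 'o, 'o \<times> 'a \<times> 'o, 'p) arrow1" where
  "kleisli_arrow P X \<phi> = \<lparr>
     ob = (\<lambda>A. A),
     ar = (\<lambda>f. (Dom P f, f \<cdot>\<^bsub>P\<^esub> Pr2 P X (Dom P f), Cod P f)),
     fib = (\<lambda>A \<alpha>. Reidx P (Pr1 P X A) \<phi> \<sqinter>\<^bsub>Fib P (X \<boxtimes>\<^bsub>P\<^esub> A)\<^esub> Reidx P (Pr2 P X A) \<alpha>)\<rparr>"

text \<open>The arrow \<open>id\<^sub>X\<close> from the terminal object to \<open>X\<close> in the Kleisli category, with \<open>X\<close> identified
  with the product of \<open>X\<close> and the terminal object.\<close>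

definition kleisli_point :: "('o, 'a, 'm) fp_cat_scheme \<Rightarrow> 'o \<Rightarrow> 'o \<times> 'a \<times> 'o" where
  "kleisli_point C X = (Term C, Pr1 C X (Term C), X)"

end

theory Submission
  imports Defs
begin

text \<open>In the Kleisli category every object \<open>A\<close> carries the arrow \<open>\<eta> : A \<leadsto> X \<times> A\<close> given by
  \<open>id\<^bsub>X \<times> A\<^esub>\<close>, and every \<open>\<beta>\<close> in the Kleisli fiber over \<open>A\<close> is the reindexing along \<open>\<eta>\<close>
  of its image in the Kleisli fiber over \<open>X \<times> A\<close>. Hence \<open>\<gg>'(\<beta>) = R(G'(\<eta>))(\<gg>(\<beta>))\<close>.
  The structure of the Kleisli doctrine is that of \<open>P\<close> over \<open>X \<times> A\<close>, cut down by a meet with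
  \<open>P(pr\<^sub>1)(\<phi>)\<close> for implications and universal quantifiers; this element is the top of the
  Kleisli fiber, so \<open>\<gg>'\<close> sends it to the top. Since reindexing along \<open>G'(\<eta>)\<close> preserves the
  structure of \<open>R\<close>, \<open>\<gg>'\<close> preserves whatever \<open>\<gg>\<close> does; for the quantifiers this is the
  Beck--Chevalley condition together with the naturality of \<open>G'(\<eta>)\<close> in \<open>A\<close>. The fibered
  equality of the Kleisli doctrine is the image of that of \<open>P\<close>, so its case is immediate.\<close>

section \<open>Meets and principal down-sets\<close>

text \<open>The doctrine predicates only assert that an equality or a quantifier exists, and the
  arrow predicates speak about all of them. Hence an explicit one is exhibited on the Kleisli
  doctrine, and uniqueness carries the computation over to an arbitrary choice. Bottom, joins and
  \<exists> are characterised by the elements above them and so remain inside a principal down-set;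
  implication and \<forall> are characterised by the elements below them and may leave it, which is
  why only these two are truncated. Two obstacles shape the rest. An element of a Kleisli fiber has
  a parameter in \<open>X\<close>, so the substitution axiom of equality is needed with parameters;
  the axiom on products supplies them. And a Kleisli quantifier over \<open>B\<close> in context
  \<open>C\<close> concerns \<open>X \<times> (C \<times> B)\<close>, that of \<open>P\<close>
  concerns \<open>(X \<times> C) \<times> B\<close>, while \<open>G\<close> preserves products only
  up to isomorphism; on the side of \<open>R\<close> this comes down to the single identity
  \<open>pair_c_assoc\<close>.\<close>

locale meet_top = lower_semilattice L + weak_partial_order_top L for L :: "'p gorder" (structure)

lemma meet_poset_iff: "meet_poset L \<longleftrightarrow> meet_top L"
  by (simp add: meet_poset_def meet_top_def)

lemma (in upper_semilattice) join_le_iff: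
  assumes "x \<in> carrier L" "y \<in> carrier L" "z \<in> carrier L"
  shows "x \<squnion> y \<sqsubseteq> z \<longleftrightarrow> x \<sqsubseteq> z \<and> y \<sqsubseteq> z"
  by (meson assms join_closed join_le join_left join_right le_trans)

context meet_top
begin

lemma le_meet_iff:
  assumes "x \<in> carrier L" "y \<in> carrier L" "z \<in> carrier L"
  shows "z \<sqsubseteq> x \<sqinter> y \<longleftrightarrow> z \<sqsubseteq> x \<and> z \<sqsubseteq> y"
  by (meson assms meet_closed meet_le meet_left meet_right le_trans)

lemma meet_mono:
  assumes "x \<in> carrier L" "y \<in> carrier L" "x' \<in> carrier L" "y' \<in> carrier L"
    and "x \<sqsubseteq> x'" "y \<sqsubseteq> y'"
  shows "x \<sqinter> y \<sqsubseteq> x' \<sqinter> y'"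
proof (subst le_meet_iff)
  show "x \<sqinter> y \<sqsubseteq> x' \<and> x \<sqinter> y \<sqsubseteq> y'"
    using assms le_trans[OF meet_left[of x y]] le_trans[OF meet_right[of x y]] by simp
qed (use assms in simp_all)

lemma le_of_meet_le:
  assumes "x \<in> carrier L" "y \<in> carrier L" "z \<in> carrier L"
  shows "x \<sqsubseteq> z \<Longrightarrow> x \<sqinter> y \<sqsubseteq> z" "y \<sqsubseteq> z \<Longrightarrow> x \<sqinter> y \<sqsubseteq> z"
  using assms le_trans[OF meet_left[of x y]] le_trans[OF meet_right[of x y]] by simp_all

text \<open>Serves the product axiom of the Kleisli equality, where every predicate carries the same
  truncation \<open>t\<close> and its two copies collapse into one.\<close>

lemma meet_meet_le:
  assumes "a \<in> carrier L" "b \<in> carrier L" "c \<in> carrier L" "t \<in> carrier L" "a \<sqinter> b \<sqsubseteq> c"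
  shows "(t \<sqinter> a) \<sqinter> (t \<sqinter> b) \<sqsubseteq> t \<sqinter> c"
proof -
  let ?m = "(t \<sqinter> a) \<sqinter> (t \<sqinter> b)"
  have "?m \<sqsubseteq> t" "?m \<sqsubseteq> a" "?m \<sqsubseteq> b"
    using assms by (auto intro: le_of_meet_le meet_left meet_right)
  then have "?m \<sqsubseteq> a \<sqinter> b" using assms by (simp add: le_meet_iff)
  then have "?m \<sqsubseteq> c" by (rule le_trans[OF _ assms(5)]) (use assms in simp_all)
  with \<open>?m \<sqsubseteq> t\<close> show ?thesis using assms by (simp add: le_meet_iff)
qed

lemma top_le_iff:
  assumes "x \<in> carrier L"
  shows "\<top> \<sqsubseteq> x \<longleftrightarrow> x = \<top>"
  using assms le_antisym by auto

lemma meet_eqI: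
  assumes "x \<in> carrier L" "y \<in> carrier L" "m \<in> carrier L" "m \<sqsubseteq> x" "m \<sqsubseteq> y"
    and "\<And>z. \<lbrakk>z \<in> carrier L; z \<sqsubseteq> x; z \<sqsubseteq> y\<rbrakk> \<Longrightarrow> z \<sqsubseteq> m"
  shows "x \<sqinter> y = m"
  by (meson assms le_antisym le_meet_iff meet_closed meet_left meet_right)

lemma meet_commute:
  assumes "x \<in> carrier L" "y \<in> carrier L"
  shows "x \<sqinter> y = y \<sqinter> x"
  using assms by (intro meet_eqI) (auto simp: le_meet_iff meet_left meet_right)

lemma meet_absorb1:
  assumes "x \<in> carrier L" "y \<in> carrier L" "x \<sqsubseteq> y"
  shows "x \<sqinter> y = x"
  using assms by (intro meet_eqI) auto

lemma meet_absorb2: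
  assumes "x \<in> carrier L" "y \<in> carrier L" "y \<sqsubseteq> x"
  shows "x \<sqinter> y = y"
  using assms by (intro meet_eqI) auto

lemma top_eqI:
  assumes "t \<in> carrier L" "\<And>x. x \<in> carrier L \<Longrightarrow> x \<sqsubseteq> t"
  shows "\<top> = t"
  using assms by (intro le_antisym) auto

lemma imp_eqI:
  assumes "is_imp L a b c"
  shows "imp L a b = c"
  unfolding imp_def
proof (rule the_equality)
  fix d assume "is_imp L a b d"
  with assms show "d = c" by (metis is_imp_def le_antisym le_refl)
qed (fact assms)

end

text \<open>Every Kleisli fiber has this form, with \<open>t\<close> the weakening of
  \<open>\<phi>\<close>; the fiberwise structure is therefore settled here once for an arbitrary
  \<open>t\<close>.\<close>

definition down :: "'p gorder \<Rightarrow> 'p \<Rightarrow> 'p gorder" where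
  "down L t = L\<lparr>carrier := {a \<in> carrier L. a \<sqsubseteq>\<^bsub>L\<^esub> t}\<rparr>"

lemma down_simps [simp]:
  "carrier (down L t) = {a \<in> carrier L. a \<sqsubseteq>\<^bsub>L\<^esub> t}"
  "le (down L t) = le L"
  "eq (down L t) = eq L"
  by (simp_all add: down_def)

context meet_top
begin

lemma down_partial_order: "partial_order (down L t)"
proof -
  have "weak_partial_order (down L t)"
    unfolding down_def by (rule weak_partial_order_subset[OF weak_partial_order_axioms]) auto
  then show ?thesis
    by (simp add: partial_order_def partial_order_axioms_def eq_is_equal)
qed

lemma down_meet_top:
  assumes t: "t \<in> carrier L"
  shows "meet_top (down L t)"
proof -
  interpret D: partial_order "down L t" by (rule down_partial_order)
  show ?thesis
  proof
    fix x y assume xy: "x \<in> carrier (down L t)" "y \<in> carrier (down L t)"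
    then have "x \<sqinter> y \<sqsubseteq> t" by (metis (no_types, lifting) down_simps(1) le_trans meet_closed meet_left mem_Collect_eq t)
    with xy have "greatest (down L t) (x \<sqinter> y) (Lower (down L t) {x, y})"
      by (auto simp: greatest_def Lower_def le_meet_iff meet_left meet_right)
    then show "\<exists>s. greatest (down L t) s (Lower (down L t) {x, y})" ..
  next
    show "\<exists>x. greatest (down L t) x (carrier (down L t))"
      using t by (auto simp: greatest_def)
  qed
qed

lemma down_top:
  assumes "t \<in> carrier L"
  shows "\<top>\<^bsub>down L t\<^esub> = t"
  using assms by (intro meet_top.top_eqI[OF down_meet_top]) auto

lemma down_meet:
  assumes "t \<in> carrier L" "x \<in> carrier (down L t)" "y \<in> carrier (down L t)"
  shows "x \<sqinter>\<^bsub>down L t\<^esub> y = x \<sqinter> y"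
proof (rule meet_top.meet_eqI[OF down_meet_top])
  show "x \<sqinter> y \<in> carrier (down L t)"
    using assms by simp (meson le_trans meet_closed meet_left)
qed (use assms in \<open>auto simp: le_meet_iff meet_left meet_right\<close>)

lemma down_bottom:
  assumes "weak_partial_order_bottom L" "t \<in> carrier L"
  shows "weak_partial_order_bottom (down L t)" "\<bottom>\<^bsub>down L t\<^esub> = \<bottom>"
proof -
  interpret B: weak_partial_order_bottom L by fact
  interpret D: partial_order "down L t" by (rule down_partial_order)
  have least: "least (down L t) \<bottom> (carrier (down L t))"
    using assms by (auto simp: least_def)
  then show bot: "weak_partial_order_bottom (down L t)"
    by unfold_locales auto
  show "\<bottom>\<^bsub>down L t\<^esub> = \<bottom>"
    by (rule D.least_unique[OF weak_partial_order_bottom.bottom_least[OF bot] least])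
qed

text \<open>If \<open>x\<close> and \<open>y\<close> lie below \<open>t\<close>, then
  \<open>t\<close> is itself an upper bound of them, so their join does not leave the
  down-set.\<close>

lemma down_join:
  assumes "upper_semilattice L" "t \<in> carrier L"
  shows "upper_semilattice (down L t)"
    and "\<lbrakk>x \<in> carrier (down L t); y \<in> carrier (down L t)\<rbrakk> \<Longrightarrow> x \<squnion>\<^bsub>down L t\<^esub> y = x \<squnion> y"
proof -
  interpret J: upper_semilattice L by fact
  interpret D: partial_order "down L t" by (rule down_partial_order)
  have least: "least (down L t) (x \<squnion> y) (Upper (down L t) {x, y})"
    if "x \<in> carrier (down L t)" "y \<in> carrier (down L t)" for x y
    using that assms by (auto simp: least_def Upper_def J.join_le_iff J.join_left J.join_right)
  then show up: "upper_semilattice (down L t)"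
    by unfold_locales blast
  interpret U: upper_semilattice "down L t" by (rule up)
  show "x \<squnion>\<^bsub>down L t\<^esub> y = x \<squnion> y" if "x \<in> carrier (down L t)" "y \<in> carrier (down L t)"
    by (rule U.joinI[OF _ that]) (rule D.least_unique[OF _ least[OF that]])
qed

text \<open>For \<open>x\<close> below \<open>t\<close>, being below \<open>c\<close> and being
  below \<open>c \<sqinter> t\<close> agree. The meet is forced by closure: \<open>c\<close> can
  exceed \<open>t\<close>, for instance when \<open>a\<close> is below \<open>b\<close> and
  \<open>c\<close> is the top.\<close>

lemma down_is_imp:
  assumes t: "t \<in> carrier L" and ab: "a \<in> carrier (down L t)" "b \<in> carrier (down L t)"
    and "is_imp L a b c"
  shows "is_imp (down L t) a b (c \<sqinter> t)"
proof -
  have "c \<in> carrier L" "\<And>x. x \<in> carrier L \<Longrightarrow> x \<sqsubseteq> c \<longleftrightarrow> x \<sqinter> a \<sqsubseteq> b"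
    using assms(4) by (auto simp: is_imp_def)
  moreover have "x \<sqinter>\<^bsub>down L t\<^esub> a = x \<sqinter> a" if "x \<in> carrier (down L t)" for x
    by (rule down_meet[OF t that ab(1)])
  ultimately show ?thesis
    using t ab by (simp add: is_imp_def le_meet_iff meet_right)
qed

end

lemma cartesian_closed_posetD:
  assumes "cartesian_closed_poset L"
  shows "meet_top L" "\<lbrakk>a \<in> carrier L; b \<in> carrier L\<rbrakk> \<Longrightarrow> is_imp L a b (imp L a b)"
  using assms meet_top.imp_eqI[of L a b]
  unfolding cartesian_closed_poset_def meet_poset_iff by auto

lemma imp_closed:
  assumes "cartesian_closed_poset L" "a \<in> carrier L" "b \<in> carrier L"
  shows "imp L a b \<in> carrier L"
  using cartesian_closed_posetD(2)[OF assms] by (simp add: is_imp_def)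

lemma down_cartesian_closed:
  fixes L :: "'p gorder" (structure)
  assumes "cartesian_closed_poset L" "t \<in> carrier L"
  shows "cartesian_closed_poset (down L t)"
    and "\<lbrakk>a \<in> carrier (down L t); b \<in> carrier (down L t)\<rbrakk>
      \<Longrightarrow> imp (down L t) a b = imp L a b \<sqinter>\<^bsub>L\<^esub> t"
proof -
  interpret meet_top L by (rule cartesian_closed_posetD(1)[OF assms(1)])
  have imp: "is_imp (down L t) a b (imp L a b \<sqinter> t)"
    if "a \<in> carrier (down L t)" "b \<in> carrier (down L t)" for a b
    using that by (intro down_is_imp[OF assms(2)] cartesian_closed_posetD(2)[OF assms(1)]) auto
  then show "cartesian_closed_poset (down L t)"
    using down_meet_top[OF assms(2)] unfolding cartesian_closed_poset_def meet_poset_iff by blast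
  show "imp (down L t) a b = imp L a b \<sqinter> t"
    if "a \<in> carrier (down L t)" "b \<in> carrier (down L t)"
    by (rule meet_top.imp_eqI[OF down_meet_top[OF assms(2)] imp[OF that]])
qed

lemma down_heyting:
  fixes L :: "'p gorder" (structure)
  assumes H: "heyting_algebra L" and t: "t \<in> carrier L"
  shows "heyting_algebra (down L t)"
proof -
  interpret bounded_lattice L using H by (simp add: heyting_algebra_def)
  interpret meet_top L ..
  interpret D: meet_top "down L t" by (rule down_meet_top[OF t])
  interpret J: upper_semilattice "down L t" by (rule down_join(1)[OF _ t]) unfold_locales
  interpret B: weak_partial_order_bottom "down L t" by (rule down_bottom(1)[OF _ t]) unfold_locales
  have "bounded_lattice (down L t)" ..
  then show ?thesis
    using H down_cartesian_closed(1)[OF _ t] by (simp add: heyting_algebra_def)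
qed

section \<open>Boolean fibers and their down-sets\<close>

definition boolean_poset :: "'p gorder \<Rightarrow> bool" where
  "boolean_poset L \<longleftrightarrow> bij_betw (neg L) (carrier L) (carrier L) \<and> order_emb (inv_gorder L) L (neg L)"

lemma is_imp_neg:
  assumes "heyting_algebra L" "a \<in> carrier L"
  shows "is_imp L a \<bottom>\<^bsub>L\<^esub> (neg L a)"
proof -
  interpret bounded_lattice L using assms by (simp add: heyting_algebra_def)
  show ?thesis
    using assms by (auto simp: neg_def heyting_algebra_def intro: cartesian_closed_posetD(2))
qed

lemma le_neg_iff:
  assumes "heyting_algebra L" "a \<in> carrier L" "x \<in> carrier L"
  shows "x \<sqsubseteq>\<^bsub>L\<^esub> neg L a \<longleftrightarrow> x \<sqinter>\<^bsub>L\<^esub> a \<sqsubseteq>\<^bsub>L\<^esub> \<bottom>\<^bsub>L\<^esub>"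
  using is_imp_neg[OF assms(1,2)] assms(3) by (simp add: is_imp_def)

text \<open>Surjectivity makes every element a negation, and triple negation collapses to a single
  one. Conversely, an involutive negation is its own inverse and reflects the order because it
  reverses it twice.\<close>

lemma boolean_poset_iff:
  fixes L :: "'p gorder" (structure)
  assumes H: "heyting_algebra L"
  shows "boolean_poset L \<longleftrightarrow> (\<forall>a\<in>carrier L. neg L (neg L a) = a)"
proof -
  interpret bounded_lattice L using H by (simp add: heyting_algebra_def)
  interpret meet_top L ..
  have nc [simp]: "neg L a \<in> carrier L" if "a \<in> carrier L" for a
    using is_imp_neg[OF H that] by (simp add: is_imp_def)
  \<comment> \<open>Both sides say that \<open>x \<sqinter> a\<close> is the bottom: negation is
    adjoint to itself. Inflation by double negation and antitonicity are read off from this.\<close>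
  have galois: "x \<sqsubseteq> neg L a \<longleftrightarrow> a \<sqsubseteq> neg L x" if "a \<in> carrier L" "x \<in> carrier L" for a x
    using that by (simp add: le_neg_iff[OF H] meet_commute)
  have infl: "a \<sqsubseteq> neg L (neg L a)" if "a \<in> carrier L" for a
    using that galois[of a "neg L a"] by simp
  have anti: "neg L b \<sqsubseteq> neg L a" if "a \<in> carrier L" "b \<in> carrier L" "a \<sqsubseteq> b" for a b
    using that galois[of a "neg L b"] le_trans[OF that(3) infl[OF that(2)]] by simp
  show ?thesis
  proof
    assume B: "boolean_poset L"
    show "\<forall>a\<in>carrier L. neg L (neg L a) = a"
    proof
      fix a assume a: "a \<in> carrier L"
      then obtain b where b: "b \<in> carrier L" "a = neg L b"
        using B by (auto simp: boolean_poset_def bij_betw_def)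
      have "neg L (neg L (neg L b)) = neg L b"
        using b by (intro le_antisym anti infl) auto
      with b show "neg L (neg L a) = a" by simp
    qed
  next
    assume dn: "\<forall>a\<in>carrier L. neg L (neg L a) = a"
    then have "bij_betw (neg L) (carrier L) (carrier L)"
      by (intro bij_betw_byWitness[where f' = "neg L"]) auto
    moreover have "order_emb (inv_gorder L) L (neg L)"
      unfolding order_emb_def
    proof (intro conjI ballI)
      show "weak_partial_order (inv_gorder L)" by (rule dual_weak_order)
      fix x y assume xy: "x \<in> carrier (inv_gorder L)" "y \<in> carrier (inv_gorder L)"
      then show "neg L x \<sqsubseteq> neg L y \<longleftrightarrow> x \<sqsubseteq>\<^bsub>inv_gorder L\<^esub> y"
        using dn anti[of y x] anti[of "neg L x" "neg L y"] by auto
    qed unfold_locales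
    ultimately show "boolean_poset L" by (simp add: boolean_poset_def)
  qed
qed

text \<open>Negation in the down-set is \<open>neg L a \<sqinter> t\<close>. Tested on
  \<open>x\<close> below \<open>t\<close>, the inner \<open>t\<close> is absorbed, so its double
  negation in the down-set is the one of \<open>L\<close> met with \<open>t\<close>, which is
  \<open>a\<close>.\<close>

lemma down_boolean:
  fixes L :: "'p gorder" (structure)
  assumes H: "heyting_algebra L" and B: "boolean_poset L" and t: "t \<in> carrier L"
  shows "boolean_poset (down L t)"
proof -
  interpret bounded_lattice L using H by (simp add: heyting_algebra_def)
  interpret meet_top L ..
  have HD: "heyting_algebra (down L t)" by (rule down_heyting[OF H t])
  interpret D: bounded_lattice "down L t" using HD by (simp add: heyting_algebra_def)
  have bot: "\<bottom>\<^bsub>down L t\<^esub> = \<bottom>" by (rule down_bottom(2)[OF _ t]) unfold_locales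
  have nc [simp]: "neg L a \<in> carrier L" if "a \<in> carrier L" for a
    using is_imp_neg[OF H that] by (simp add: is_imp_def)
  have neg: "neg (down L t) a = neg L a \<sqinter> t" if "a \<in> carrier (down L t)" for a
    using that down_cartesian_closed(2)[OF _ t that D.bottom_closed] H
    by (simp add: neg_def bot heyting_algebra_def)
  have "neg L (neg L a \<sqinter> t) \<sqinter> t = a" if "a \<in> carrier (down L t)" for a
  proof -
    from that have a: "a \<in> carrier L" "a \<sqsubseteq> t" by auto
    have "x \<sqsubseteq> neg L (neg L a \<sqinter> t) \<longleftrightarrow> x \<sqsubseteq> a" if "x \<in> carrier L" "x \<sqsubseteq> t" for x
    proof -
      have "x \<sqinter> (neg L a \<sqinter> t) = x \<sqinter> neg L a"
        using that a t
        by (intro le_antisym) (auto simp: le_meet_iff meet_left meet_right intro: le_trans[OF meet_left] le_trans[OF meet_right])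
      moreover have "neg L (neg L a) = a" using B a boolean_poset_iff[OF H] by blast
      ultimately show ?thesis
        using that a t le_neg_iff[OF H, of "neg L a \<sqinter> t" x] le_neg_iff[OF H, of "neg L a" x] by simp
    qed
    then show ?thesis
      using a t by (intro meet_eqI) auto
  qed
  moreover have "neg (down L t) (neg (down L t) a) = neg L (neg L a \<sqinter> t) \<sqinter> t"
    if "a \<in> carrier (down L t)" for a
    using that t by (subst neg) (auto simp: neg meet_right)
  ultimately show ?thesis
    by (simp add: boolean_poset_iff[OF HD])
qed


section \<open>Equational calculus of categories with finite products\<close>

lemma Hom_iff: "f \<in> Hom C A B \<longleftrightarrow> f \<in> Arr C \<and> Dom C f = A \<and> Cod C f = B"
  by (auto simp: Hom_def)

text \<open>Typing through \<open>Arr\<close>, \<open>Dom\<close> and \<open>Cod\<close> instead of \<open>Hom\<close> leaves no unbound variables in the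
  premises, so that the simplifier decides the equations between composites of tuples and
  projections.\<close>

context category
begin

lemma Dom_in_Obj [simp]: "f \<in> Arr C \<Longrightarrow> Dom C f \<in> Obj C"
  and Cod_in_Obj [simp]: "f \<in> Arr C \<Longrightarrow> Cod C f \<in> Obj C"
  by (fact Dom_Obj, fact Cod_Obj)

lemma Id_typing [simp]:
  assumes "A \<in> Obj C"
  shows "Id C A \<in> Arr C" "Dom C (Id C A) = A" "Cod C (Id C A) = A"
  using Id_Hom[OF assms] by (auto simp: Hom_iff)

lemma Comp_typing [simp]:
  assumes "f \<in> Arr C" "g \<in> Arr C" "Cod C f = Dom C g"
  shows "g \<cdot> f \<in> Arr C" "Dom C (g \<cdot> f) = Dom C f" "Cod C (g \<cdot> f) = Cod C g"
  using Comp_Hom[of f "Dom C f" "Cod C f" g "Cod C g"] assms by (auto simp: Hom_iff)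

lemma Comp_Id [simp]:
  "\<lbrakk>f \<in> Arr C; Cod C f = B\<rbrakk> \<Longrightarrow> Id C B \<cdot> f = f"
  "\<lbrakk>f \<in> Arr C; Dom C f = A\<rbrakk> \<Longrightarrow> f \<cdot> Id C A = f"
  by (auto intro: Id_left Id_right simp: Hom_iff)

lemma Comp_Comp [simp]:
  assumes "f \<in> Arr C" "g \<in> Arr C" "h \<in> Arr C" "Cod C f = Dom C g" "Cod C g = Dom C h"
  shows "(h \<cdot> g) \<cdot> f = h \<cdot> g \<cdot> f"
  using Comp_assoc[of f "Dom C f" "Cod C f" g "Cod C g" h "Cod C h"] assms by (simp add: Hom_iff)

end

lemma is_productD:
  assumes "is_product C A B Q p q"
  shows "Q \<in> Obj C" "p \<in> Arr C" "Dom C p = Q" "Cod C p = A" "q \<in> Arr C" "Dom C q = Q" "Cod C q = B"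
  using assms unfolding is_product_def Hom_iff by blast+

context category
begin

text \<open>The common domain is written \<open>Dom C g\<close>, the side towards which the
  simplifier turns the premise on domains; the typing rules for tuples follow the same
  choice.\<close>

lemma is_product_ex1:
  assumes "is_product C A B Q p q" "f \<in> Arr C" "g \<in> Arr C" "Dom C f = Dom C g"
    "Cod C f = A" "Cod C g = B"
  shows "\<exists>!h. h \<in> Hom C (Dom C g) Q \<and> p \<cdot> h = f \<and> q \<cdot> h = g"
proof -
  have "Dom C g \<in> Obj C" "f \<in> Hom C (Dom C g) A" "g \<in> Hom C (Dom C g) B"
    using assms by (simp_all add: Hom_iff)
  with assms(1) show ?thesis unfolding is_product_def by blast
qed

lemma mediate_props:
  assumes "is_product C A B Q p q" "f \<in> Arr C" "g \<in> Arr C" "Dom C f = Dom C g"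
    "Cod C f = A" "Cod C g = B"
  shows "mediate C Q p q f g \<in> Arr C" "Dom C (mediate C Q p q f g) = Dom C g"
    "Cod C (mediate C Q p q f g) = Q"
    "p \<cdot> mediate C Q p q f g = f" "q \<cdot> mediate C Q p q f g = g"
proof -
  have "mediate C Q p q f g \<in> Hom C (Dom C g) Q \<and> p \<cdot> mediate C Q p q f g = f
      \<and> q \<cdot> mediate C Q p q f g = g"
    unfolding mediate_def assms(4) by (rule theI'[OF is_product_ex1[OF assms]])
  then show "mediate C Q p q f g \<in> Arr C" "Dom C (mediate C Q p q f g) = Dom C g"
    "Cod C (mediate C Q p q f g) = Q"
    "p \<cdot> mediate C Q p q f g = f" "q \<cdot> mediate C Q p q f g = g"
    by (simp_all add: Hom_iff)
qed

text \<open>Stated for an arbitrary cone because it is also applied in \<open>R\<close> to the image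
  under \<open>G\<close> of a product of \<open>P\<close>, which need not be the chosen
  product.\<close>

lemma product_jointly_monic:
  assumes Q: "is_product C A B Q p q"
    and "h \<in> Arr C" "k \<in> Arr C" "Dom C h = Dom C k" "Cod C h = Q" "Cod C k = Q"
    and "p \<cdot> h = p \<cdot> k" "q \<cdot> h = q \<cdot> k"
  shows "h = k"
proof -
  have "\<exists>!h. h \<in> Hom C (Dom C k) Q \<and> p \<cdot> h = p \<cdot> k \<and> q \<cdot> h = q \<cdot> k"
    using is_product_ex1[OF Q, of "p \<cdot> k" "q \<cdot> k"] assms is_productD[OF Q] by simp
  moreover have "h \<in> Hom C (Dom C k) Q" "k \<in> Hom C (Dom C k) Q"
    using assms by (simp_all add: Hom_iff)
  ultimately show ?thesis using assms(7,8) by blast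
qed

end

context fp_category
begin

lemma Prod_in_Obj [simp]: "\<lbrakk>A \<in> Obj C; B \<in> Obj C\<rbrakk> \<Longrightarrow> A \<boxtimes> B \<in> Obj C"
  by (rule is_productD(1)[OF Prod_product])

lemma Pr_typing [simp]:
  assumes "A \<in> Obj C" "B \<in> Obj C"
  shows "Pr1 C A B \<in> Arr C" "Dom C (Pr1 C A B) = A \<boxtimes> B" "Cod C (Pr1 C A B) = A"
    "Pr2 C A B \<in> Arr C" "Dom C (Pr2 C A B) = A \<boxtimes> B" "Cod C (Pr2 C A B) = B"
  using is_productD[OF Prod_product[OF assms]] by auto

lemma tuple_typing [simp]:
  assumes "f \<in> Arr C" "g \<in> Arr C" "Dom C f = Dom C g"
  shows "\<langle>f, g\<rangle> \<in> Arr C" "Dom C \<langle>f, g\<rangle> = Dom C g" "Cod C \<langle>f, g\<rangle> = Cod C f \<boxtimes> Cod C g"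
  using mediate_props[OF Prod_product, of "Cod C f" "Cod C g" f g] assms by (auto simp: tuple_def)

lemma Pr_tuple [simp]:
  assumes "f \<in> Arr C" "g \<in> Arr C" "Dom C f = Dom C g" "Cod C f = A" "Cod C g = B"
  shows "Pr1 C A B \<cdot> \<langle>f, g\<rangle> = f" "Pr2 C A B \<cdot> \<langle>f, g\<rangle> = g"
  using mediate_props[OF Prod_product, of A B f g] assms by (auto simp: tuple_def)

text \<open>Composites are normalised to the right, which hides the redex of
  \<open>Pr_tuple\<close>. These variants recover it and yield \<open>tuple_Comp\<close>.\<close>

lemma Pr_tuple_Comp [simp]:
  assumes "f \<in> Arr C" "g \<in> Arr C" "h \<in> Arr C" "Dom C f = Dom C g" "Cod C h = Dom C g"
    "Cod C f = A" "Cod C g = B"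
  shows "Pr1 C A B \<cdot> \<langle>f, g\<rangle> \<cdot> h = f \<cdot> h" "Pr2 C A B \<cdot> \<langle>f, g\<rangle> \<cdot> h = g \<cdot> h"
  using assms(1-5) unfolding assms(6,7)[symmetric]
  by (subst Comp_Comp[symmetric]; simp del: Comp_Comp)+

lemma Pr_jointly_monic:
  assumes "h \<in> Arr C" "k \<in> Arr C" "Dom C h = Dom C k" "Cod C h = A \<boxtimes> B" "Cod C k = A \<boxtimes> B"
    "A \<in> Obj C" "B \<in> Obj C"
    and "Pr1 C A B \<cdot> h = Pr1 C A B \<cdot> k" "Pr2 C A B \<cdot> h = Pr2 C A B \<cdot> k"
  shows "h = k"
  by (rule product_jointly_monic[OF Prod_product]) (fact assms)+

lemma tuple_eqI:
  assumes "h \<in> Arr C" "Cod C h = A \<boxtimes> B" "A \<in> Obj C" "B \<in> Obj C"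
    and "Pr1 C A B \<cdot> h = f" "Pr2 C A B \<cdot> h = g"
  shows "\<langle>f, g\<rangle> = h"
  by (rule Pr_jointly_monic[of _ _ A B]) (use assms in auto)

lemma tuple_Comp [simp]:
  assumes "f \<in> Arr C" "g \<in> Arr C" "h \<in> Arr C" "Dom C f = Dom C g" "Cod C h = Dom C g"
  shows "\<langle>f, g\<rangle> \<cdot> h = \<langle>f \<cdot> h, g \<cdot> h\<rangle>"
  by (rule sym, rule tuple_eqI[of _ "Cod C f" "Cod C g"]) (use assms in auto)

lemma tuple_Pr [simp]:
  "\<lbrakk>A \<in> Obj C; B \<in> Obj C\<rbrakk> \<Longrightarrow> \<langle>Pr1 C A B, Pr2 C A B\<rangle> = Id C (A \<boxtimes> B)"
  "\<lbrakk>A \<in> Obj C; B \<in> Obj C; h \<in> Arr C; Cod C h = A \<boxtimes> B\<rbrakk> \<Longrightarrow> \<langle>Pr1 C A B \<cdot> h, Pr2 C A B \<cdot> h\<rangle> = h"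
  by (rule tuple_eqI[of _ A B]; auto)+

lemma times_id_typing [simp]:
  assumes "f \<in> Arr C" "B \<in> Obj C"
  shows "times_id C f B \<in> Arr C" "Dom C (times_id C f B) = Dom C f \<boxtimes> B"
    "Cod C (times_id C f B) = Cod C f \<boxtimes> B"
  using assms by (simp_all add: times_id_def)

text \<open>Mediates between \<open>X \<times> (C \<times> B)\<close>, over which the Kleisli fiber
  of \<open>C \<times> B\<close> lives, and \<open>(X \<times> C) \<times> B\<close>, where
  \<open>P\<close> quantifies over \<open>B\<close>. Reindexing along \<open>assoc_inv\<close>
  brings a predicate into the second form.\<close>

definition assoc :: "'o \<Rightarrow> 'o \<Rightarrow> 'o \<Rightarrow> 'a" where
  "assoc A B D = \<langle>\<langle>Pr1 C A (B \<boxtimes> D), Pr1 C B D \<cdot> Pr2 C A (B \<boxtimes> D)\<rangle>, Pr2 C B D \<cdot> Pr2 C A (B \<boxtimes> D)\<rangle>"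

definition assoc_inv :: "'o \<Rightarrow> 'o \<Rightarrow> 'o \<Rightarrow> 'a" where
  "assoc_inv A B D = \<langle>Pr1 C A B \<cdot> Pr1 C (A \<boxtimes> B) D, \<langle>Pr2 C A B \<cdot> Pr1 C (A \<boxtimes> B) D, Pr2 C (A \<boxtimes> B) D\<rangle>\<rangle>"

lemma assoc_typing [simp]:
  assumes "A \<in> Obj C" "B \<in> Obj C" "D \<in> Obj C"
  shows "assoc A B D \<in> Arr C" "Dom C (assoc A B D) = A \<boxtimes> B \<boxtimes> D" "Cod C (assoc A B D) = (A \<boxtimes> B) \<boxtimes> D"
    "assoc_inv A B D \<in> Arr C" "Dom C (assoc_inv A B D) = (A \<boxtimes> B) \<boxtimes> D" "Cod C (assoc_inv A B D) = A \<boxtimes> B \<boxtimes> D"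
  using assms by (simp_all add: assoc_def assoc_inv_def)

lemma assoc_inverse:
  assumes "A \<in> Obj C" "B \<in> Obj C" "D \<in> Obj C"
  shows "assoc A B D \<cdot> assoc_inv A B D = Id C ((A \<boxtimes> B) \<boxtimes> D)"
    and "assoc_inv A B D \<cdot> assoc A B D = Id C (A \<boxtimes> B \<boxtimes> D)"
  using assms by (simp_all add: assoc_def assoc_inv_def)

end


section \<open>Uniqueness of fibered equalities and quantifiers\<close>

context doctrine
begin

lemma Reidx_in_carrier [simp]:
  assumes "f \<in> Arr P" "Dom P f = A" "\<alpha> \<in> carrier (Fib P (Cod P f))"
  shows "Reidx P f \<alpha> \<in> carrier (Fib P A)"
  using Reidx_closed[of f A "Cod P f"] assms by (auto simp: Hom_iff)

lemma Reidx_le: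
  assumes "f \<in> Arr P" "Dom P f = A" "Cod P f = B" "\<alpha> \<in> carrier (Fib P B)" "\<beta> \<in> carrier (Fib P B)"
    "\<alpha> \<sqsubseteq>\<^bsub>Fib P B\<^esub> \<beta>"
  shows "Reidx P f \<alpha> \<sqsubseteq>\<^bsub>Fib P A\<^esub> Reidx P f \<beta>"
  using use_iso2[OF Reidx_mono] assms by (auto simp: Hom_iff)

lemma Reidx_Id_eq [simp]: "\<lbrakk>A \<in> Obj P; \<alpha> \<in> carrier (Fib P A)\<rbrakk> \<Longrightarrow> Reidx P (Id P A) \<alpha> = \<alpha>"
  by (rule Reidx_Id)

lemma Reidx_Reidx [simp]:
  assumes "f \<in> Arr P" "g \<in> Arr P" "Cod P f = Dom P g" "\<alpha> \<in> carrier (Fib P (Cod P g))"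
  shows "Reidx P f (Reidx P g \<alpha>) = Reidx P (g \<cdot> f) \<alpha>"
  using Reidx_Comp[of f "Dom P f" "Cod P f" g "Cod P g"] assms by (simp add: Hom_iff)

text \<open>Reindexing along mutually inverse arrows is an order isomorphism. This form as an
  adjunction chains directly with the adjunctions of the quantifiers.\<close>

lemma Reidx_iso_le_iff:
  assumes "f \<in> Arr P" "g \<in> Arr P" "Dom P f = A" "Cod P f = B" "Dom P g = B" "Cod P g = A"
    and "g \<cdot> f = Id P A" "f \<cdot> g = Id P B"
    and "\<alpha> \<in> carrier (Fib P B)" "\<beta> \<in> carrier (Fib P A)"
  shows "Reidx P f \<alpha> \<sqsubseteq>\<^bsub>Fib P A\<^esub> \<beta> \<longleftrightarrow> \<alpha> \<sqsubseteq>\<^bsub>Fib P B\<^esub> Reidx P g \<beta>"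
proof -
  have obj: "A \<in> Obj P" "B \<in> Obj P" using assms by auto
  have inverse: "Reidx P g (Reidx P f \<alpha>) = \<alpha>" "Reidx P f (Reidx P g \<beta>) = \<beta>"
    using assms obj by simp_all
  show ?thesis
    using Reidx_le[of f A B \<alpha> "Reidx P g \<beta>"] Reidx_le[of g B A "Reidx P f \<alpha>" \<beta>] assms
    unfolding inverse by auto
qed

section \<open>Quantifiers as adjoints, and their uniqueness\<close>

lemma existential_quantifier_closed:
  assumes "existential_quantifier P E" "B \<in> Obj P" "C \<in> Obj P" "\<alpha> \<in> carrier (Fib P (C \<boxtimes> B))"
  shows "E B C \<alpha> \<in> carrier (Fib P C)"
proof -
  interpret galois_connection "\<lparr>orderA = Fib P (C \<boxtimes> B), orderB = Fib P C, lower = E B C, upper = Reidx P (Pr1 P C B)\<rparr>"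
    using assms by (simp add: existential_quantifier_def)
  show ?thesis using lower_closed assms(4) by simp
qed

lemma existential_quantifier_le_iff:
  assumes "existential_quantifier P E" "B \<in> Obj P" "C \<in> Obj P" "\<alpha> \<in> carrier (Fib P (C \<boxtimes> B))"
    "\<beta> \<in> carrier (Fib P C)"
  shows "E B C \<alpha> \<sqsubseteq>\<^bsub>Fib P C\<^esub> \<beta> \<longleftrightarrow> \<alpha> \<sqsubseteq>\<^bsub>Fib P (C \<boxtimes> B)\<^esub> Reidx P (Pr1 P C B) \<beta>"
proof -
  interpret galois_connection "\<lparr>orderA = Fib P (C \<boxtimes> B), orderB = Fib P C, lower = E B C, upper = Reidx P (Pr1 P C B)\<rparr>"
    using assms by (simp add: existential_quantifier_def)
  show ?thesis using galois_property assms(4,5) by simp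
qed

text \<open>Each value lies below the other because both are the least \<open>\<beta>\<close> whose
  weakening lies above \<open>\<alpha>\<close>. This lets the explicit Kleisli quantifier replace an
  arbitrary one in \<open>existential_arrow\<close>.\<close>

lemma existential_quantifier_unique:
  assumes E: "existential_quantifier P E" and E': "existential_quantifier P E'"
    and BC: "B \<in> Obj P" "C \<in> Obj P" "\<alpha> \<in> carrier (Fib P (C \<boxtimes> B))"
  shows "E B C \<alpha> = E' B C \<alpha>"
proof -
  interpret partial_order "Fib P C" using BC by (intro Fib_po)
  note closed = existential_quantifier_closed[OF E BC] existential_quantifier_closed[OF E' BC]
  show ?thesis
    using existential_quantifier_le_iff[OF E BC closed(1)] existential_quantifier_le_iff[OF E BC closed(2)]
      existential_quantifier_le_iff[OF E' BC closed(1)] existential_quantifier_le_iff[OF E' BC closed(2)]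
    by (intro le_antisym) (simp_all add: closed)
qed

lemma existential_quantifier_Reidx:
  assumes "existential_quantifier P E" "B \<in> Obj P" "f \<in> Arr P" "Dom P f = C" "Cod P f = C'"
    "\<alpha> \<in> carrier (Fib P (C' \<boxtimes> B))"
  shows "Reidx P f (E B C' \<alpha>) = E B C (Reidx P (times_id P f B) \<alpha>)"
proof -
  have "f \<in> Hom P C C'" using assms by (simp add: Hom_iff)
  with assms show ?thesis unfolding existential_quantifier_def by auto
qed

lemma existential_quantifier_Frobenius:
  assumes "existential_quantifier P E" "B \<in> Obj P" "C \<in> Obj P"
    "\<alpha> \<in> carrier (Fib P (C \<boxtimes> B))" "\<beta> \<in> carrier (Fib P C)"
  shows "E B C (\<alpha> \<sqinter>\<^bsub>Fib P (C \<boxtimes> B)\<^esub> Reidx P (Pr1 P C B) \<beta>) = E B C \<alpha> \<sqinter>\<^bsub>Fib P C\<^esub> \<beta>"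
  using assms unfolding existential_quantifier_def by blast

lemma universal_quantifier_closed:
  assumes "universal_quantifier P U" "B \<in> Obj P" "C \<in> Obj P" "\<alpha> \<in> carrier (Fib P (C \<boxtimes> B))"
  shows "U B C \<alpha> \<in> carrier (Fib P C)"
proof -
  interpret galois_connection "\<lparr>orderA = Fib P C, orderB = Fib P (C \<boxtimes> B), lower = Reidx P (Pr1 P C B), upper = U B C\<rparr>"
    using assms by (simp add: universal_quantifier_def)
  show ?thesis using upper_closed assms(4) by simp
qed

lemma le_universal_quantifier_iff:
  assumes "universal_quantifier P U" "B \<in> Obj P" "C \<in> Obj P" "\<alpha> \<in> carrier (Fib P (C \<boxtimes> B))"
    "\<beta> \<in> carrier (Fib P C)"
  shows "\<beta> \<sqsubseteq>\<^bsub>Fib P C\<^esub> U B C \<alpha> \<longleftrightarrow> Reidx P (Pr1 P C B) \<beta> \<sqsubseteq>\<^bsub>Fib P (C \<boxtimes> B)\<^esub> \<alpha>"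
proof -
  interpret galois_connection "\<lparr>orderA = Fib P C, orderB = Fib P (C \<boxtimes> B), lower = Reidx P (Pr1 P C B), upper = U B C\<rparr>"
    using assms by (simp add: universal_quantifier_def)
  show ?thesis using galois_property assms(4,5) by simp
qed

lemma universal_quantifier_unique:
  assumes U: "universal_quantifier P U" and U': "universal_quantifier P U'"
    and BC: "B \<in> Obj P" "C \<in> Obj P" "\<alpha> \<in> carrier (Fib P (C \<boxtimes> B))"
  shows "U B C \<alpha> = U' B C \<alpha>"
proof -
  interpret partial_order "Fib P C" using BC by (intro Fib_po)
  note closed = universal_quantifier_closed[OF U BC] universal_quantifier_closed[OF U' BC]
  show ?thesis
    using le_universal_quantifier_iff[OF U BC closed(1)] le_universal_quantifier_iff[OF U BC closed(2)]
      le_universal_quantifier_iff[OF U' BC closed(1)] le_universal_quantifier_iff[OF U' BC closed(2)]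
    by (intro le_antisym) (simp_all add: closed)
qed

lemma universal_quantifier_Reidx:
  assumes "universal_quantifier P U" "B \<in> Obj P" "f \<in> Arr P" "Dom P f = C" "Cod P f = C'"
    "\<alpha> \<in> carrier (Fib P (C' \<boxtimes> B))"
  shows "Reidx P f (U B C' \<alpha>) = U B C (Reidx P (times_id P f B) \<alpha>)"
proof -
  have "f \<in> Hom P C C'" using assms by (simp add: Hom_iff)
  with assms show ?thesis unfolding universal_quantifier_def by auto
qed

end

locale primary_doctrine = doctrine P for P :: "('o, 'a, 'p) doctrine" (structure) +
  assumes Fib_meet_top: "A \<in> Obj P \<Longrightarrow> meet_top (Fib P A)"
    and Reidx_Hom_top: "f \<in> Hom P A B \<Longrightarrow> preserves_top (Fib P B) (Fib P A) (Reidx P f)"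
    and Reidx_Hom_meet: "f \<in> Hom P A B \<Longrightarrow> preserves_meet (Fib P B) (Fib P A) (Reidx P f)"

lemma primary_iff: "primary P \<longleftrightarrow> primary_doctrine P"
  unfolding primary_def primary_doctrine_def primary_doctrine_axioms_def meet_poset_iff by blast

context primary_doctrine
begin

lemma Reidx_top [simp]:
  assumes "f \<in> Arr P" "Cod P f = B"
  shows "Reidx P f \<top>\<^bsub>Fib P B\<^esub> = \<top>\<^bsub>Fib P (Dom P f)\<^esub>"
  using Reidx_Hom_top[of f "Dom P f" B] assms by (simp add: Hom_iff preserves_top_def)

lemma Reidx_meet [simp]:
  assumes "f \<in> Arr P" "Cod P f = B" "\<alpha> \<in> carrier (Fib P B)" "\<beta> \<in> carrier (Fib P B)"
  shows "Reidx P f (\<alpha> \<sqinter>\<^bsub>Fib P B\<^esub> \<beta>) = Reidx P f \<alpha> \<sqinter>\<^bsub>Fib P (Dom P f)\<^esub> Reidx P f \<beta>"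
  using Reidx_Hom_meet[of f "Dom P f" B] assms by (simp add: Hom_iff preserves_meet_def)

lemma top_in_carrier [simp]: "A \<in> Obj P \<Longrightarrow> \<top>\<^bsub>Fib P A\<^esub> \<in> carrier (Fib P A)"
proof -
  assume "A \<in> Obj P"
  then interpret meet_top "Fib P A" by (rule Fib_meet_top)
  show ?thesis by simp
qed

lemma meet_in_carrier [simp]:
  assumes "A \<in> Obj P" "\<alpha> \<in> carrier (Fib P A)" "\<beta> \<in> carrier (Fib P A)"
  shows "\<alpha> \<sqinter>\<^bsub>Fib P A\<^esub> \<beta> \<in> carrier (Fib P A)"
proof -
  interpret meet_top "Fib P A" using assms by (intro Fib_meet_top)
  show ?thesis using assms by simp
qed

text \<open>Reflexivity is an equation with the top, which every reindexing preserves; so it holds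
  for all generalised elements \<open>u\<close>, not only the identity.\<close>

lemma fibered_equality_refl:
  assumes \<delta>: "fibered_equality P \<delta>" and u: "u \<in> Arr P" "Cod P u = A"
  shows "Reidx P \<langle>u, u\<rangle> (\<delta> A) = \<top>\<^bsub>Fib P (Dom P u)\<^esub>"
proof -
  have A: "A \<in> Obj P" using u by auto
  interpret meet_top "Fib P A" using A by (rule Fib_meet_top)
  have "Reidx P \<langle>Id P A, Id P A\<rangle> (\<delta> A) = \<top>\<^bsub>Fib P A\<^esub>"
    using \<delta> A by (subst top_le_iff[symmetric]) (auto simp: fibered_equality_def)
  then have "Reidx P u (Reidx P \<langle>Id P A, Id P A\<rangle> (\<delta> A)) = \<top>\<^bsub>Fib P (Dom P u)\<^esub>"
    using u by simp
  then show ?thesis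
    using \<delta> A u by (simp add: fibered_equality_def)
qed

text \<open>Substitution with parameters: apply the substitution axiom to \<open>X \<times> A\<close>, whose equality is
  bounded below by those of \<open>X\<close> and \<open>A\<close>, and reindex along \<open>(x, a, b) \<mapsto> ((x, a), (x, b))\<close>.\<close>

lemma fibered_equality_subst:
  assumes \<delta>: "fibered_equality P \<delta>"
    and uvw: "u \<in> Arr P" "v \<in> Arr P" "w \<in> Arr P" "Dom P u = Z" "Dom P v = Z" "Dom P w = Z"
      "Cod P u = X" "Cod P v = A" "Cod P w = A"
    and \<alpha>: "\<alpha> \<in> carrier (Fib P (X \<boxtimes> A))"
  shows "Reidx P \<langle>u, v\<rangle> \<alpha> \<sqinter>\<^bsub>Fib P Z\<^esub> Reidx P \<langle>v, w\<rangle> (\<delta> A) \<sqsubseteq>\<^bsub>Fib P Z\<^esub> Reidx P \<langle>u, w\<rangle> \<alpha>"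
proof -
  have obj [simp]: "X \<in> Obj P" "A \<in> Obj P" "Z \<in> Obj P" using uvw by auto
  interpret Z: meet_top "Fib P Z" by (rule Fib_meet_top) simp
  have \<delta>_closed [simp]: "\<delta> B \<in> carrier (Fib P (B \<boxtimes> B))" if "B \<in> Obj P" for B
    using \<delta> that by (simp add: fibered_equality_def)
  define Q where "Q = X \<boxtimes> A"
  have Q [simp]: "Q \<in> Obj P" by (simp add: Q_def)
  have XA [simp]: "X \<boxtimes> A = Q" by (simp add: Q_def)
  have \<alpha>Q [simp]: "\<alpha> \<in> carrier (Fib P Q)" using \<alpha> by simp
  have Pr_XA [simp]: "Dom P (Pr1 P X A) = Q" "Dom P (Pr2 P X A) = Q" by simp_all
  define h where "h = \<langle>\<langle>u, v\<rangle>, \<langle>u, w\<rangle>\<rangle>"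
  have h [simp]: "h \<in> Arr P" "Dom P h = Z" "Cod P h = Q \<boxtimes> Q"
    using uvw by (simp_all add: h_def)
  have Pr_h [simp]: "Pr1 P Q Q \<cdot> h = \<langle>u, v\<rangle>" "Pr2 P Q Q \<cdot> h = \<langle>u, w\<rangle>"
    using uvw by (simp_all add: h_def)
  let ?\<delta>Q = "Reidx P h (\<delta> Q)"
  have "Reidx P (Pr1 P Q Q) \<alpha> \<sqinter>\<^bsub>Fib P (Q \<boxtimes> Q)\<^esub> \<delta> Q \<sqsubseteq>\<^bsub>Fib P (Q \<boxtimes> Q)\<^esub> Reidx P (Pr2 P Q Q) \<alpha>"
    using \<delta> \<alpha> Q unfolding fibered_equality_def Q_def by blast
  then have "Reidx P h (Reidx P (Pr1 P Q Q) \<alpha> \<sqinter>\<^bsub>Fib P (Q \<boxtimes> Q)\<^esub> \<delta> Q)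
      \<sqsubseteq>\<^bsub>Fib P Z\<^esub> Reidx P h (Reidx P (Pr2 P Q Q) \<alpha>)"
    using \<alpha> by (intro Reidx_le[of h]) auto
  then have subst: "Reidx P \<langle>u, v\<rangle> \<alpha> \<sqinter>\<^bsub>Fib P Z\<^esub> ?\<delta>Q \<sqsubseteq>\<^bsub>Fib P Z\<^esub> Reidx P \<langle>u, w\<rangle> \<alpha>"
    using \<alpha> by simp
  define p where "p = \<langle>Pr1 P X A \<cdot> Pr1 P Q Q, Pr1 P X A \<cdot> Pr2 P Q Q\<rangle>"
  define q where "q = \<langle>Pr2 P X A \<cdot> Pr1 P Q Q, Pr2 P X A \<cdot> Pr2 P Q Q\<rangle>"
  have pq [simp]: "p \<in> Arr P" "Dom P p = Q \<boxtimes> Q" "Cod P p = X \<boxtimes> X"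
      "q \<in> Arr P" "Dom P q = Q \<boxtimes> Q" "Cod P q = A \<boxtimes> A"
    by (simp_all add: p_def q_def)
  have "Pr1 P X A \<cdot> Pr1 P Q Q \<cdot> h = u" "Pr1 P X A \<cdot> Pr2 P Q Q \<cdot> h = u"
      "Pr2 P X A \<cdot> Pr1 P Q Q \<cdot> h = v" "Pr2 P X A \<cdot> Pr2 P Q Q \<cdot> h = w"
    using uvw by (simp_all only: Pr_h) simp_all
  then have pqh: "p \<cdot> h = \<langle>u, u\<rangle>" "q \<cdot> h = \<langle>v, w\<rangle>"
    by (simp_all add: p_def q_def)
  have "Reidx P p (\<delta> X) \<sqinter>\<^bsub>Fib P (Q \<boxtimes> Q)\<^esub> Reidx P q (\<delta> A) \<sqsubseteq>\<^bsub>Fib P (Q \<boxtimes> Q)\<^esub> \<delta> Q"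
    using \<delta> obj unfolding fibered_equality_def p_def q_def Q_def Let_def by blast
  then have "Reidx P h (Reidx P p (\<delta> X) \<sqinter>\<^bsub>Fib P (Q \<boxtimes> Q)\<^esub> Reidx P q (\<delta> A)) \<sqsubseteq>\<^bsub>Fib P Z\<^esub> ?\<delta>Q"
    by (intro Reidx_le[of h]) auto
  \<comment> \<open>Both \<open>X\<close> coordinates of \<open>h\<close> are \<open>u\<close>, so
    the equality of \<open>X\<close> becomes the top and drops out of the meet.\<close>
  then have "Reidx P \<langle>v, w\<rangle> (\<delta> A) \<sqsubseteq>\<^bsub>Fib P Z\<^esub> ?\<delta>Q"
    using uvw by (simp add: pqh fibered_equality_refl[OF \<delta>] Z.meet_absorb2)
  moreover have "Reidx P \<langle>u, v\<rangle> \<alpha> \<in> carrier (Fib P Z)" "Reidx P \<langle>v, w\<rangle> (\<delta> A) \<in> carrier (Fib P Z)"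
      "Reidx P \<langle>u, w\<rangle> \<alpha> \<in> carrier (Fib P Z)" "?\<delta>Q \<in> carrier (Fib P Z)"
    using uvw by simp_all
  ultimately show ?thesis
    by (intro Z.le_trans[OF Z.meet_mono subst]) simp_all
qed

text \<open>Leibniz's argument: substitute along \<open>\<delta>\<close> in the second variable of
  the predicate \<open>\<epsilon> A\<close>, starting from \<open>\<epsilon>\<close> on the
  diagonal, which is the top.\<close>

lemma fibered_equality_le:
  assumes \<delta>: "fibered_equality P \<delta>" and \<epsilon>: "fibered_equality P \<epsilon>" and A [simp]: "A \<in> Obj P"
  shows "\<delta> A \<sqsubseteq>\<^bsub>Fib P (A \<boxtimes> A)\<^esub> \<epsilon> A"
proof -
  interpret meet_top "Fib P (A \<boxtimes> A)" by (rule Fib_meet_top) simp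
  have [simp]: "\<delta> A \<in> carrier (Fib P (A \<boxtimes> A))" "\<epsilon> A \<in> carrier (Fib P (A \<boxtimes> A))"
    using \<delta> \<epsilon> A unfolding fibered_equality_def by blast+
  show ?thesis
    using fibered_equality_subst[OF \<delta>, of "Pr1 P A A" "Pr1 P A A" "Pr2 P A A" "A \<boxtimes> A" A A "\<epsilon> A"]
    by (simp add: fibered_equality_refl[OF \<epsilon>] meet_absorb2)
qed

lemma fibered_equality_unique:
  assumes "fibered_equality P \<delta>" "fibered_equality P \<epsilon>" "A \<in> Obj P"
  shows "\<delta> A = \<epsilon> A"
proof -
  interpret meet_top "Fib P (A \<boxtimes> A)" using assms by (intro Fib_meet_top) simp
  show ?thesis
    using assms by (intro le_antisym fibered_equality_le) (auto simp: fibered_equality_def)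
qed

end


section \<open>The structure of the Kleisli doctrine\<close>

text \<open>That the Kleisli doctrine is primary enters as an assumption, since
  \<open>primary_arrow\<close> for \<open>G'\<close> contains it. It also supplies the finite
  products of the Kleisli category.\<close>

locale kleisli = primary_doctrine P for P :: "('o, 'a, 'p) doctrine" (structure) +
  fixes X :: 'o and \<phi> :: 'p
  assumes X_in_Obj [simp]: "X \<in> Obj P"
    and \<phi>_in_carrier [simp]: "\<phi> \<in> carrier (Fib P X)"
    and kleisli_primary: "primary_doctrine (kleisli_doctrine P X \<phi>)"
begin

abbreviation K :: "('o, 'o \<times> 'a \<times> 'o, 'p) doctrine" where
  "K \<equiv> kleisli_doctrine P X \<phi>"

abbreviation F :: "('o, 'a, 'p, 'o, 'o \<times> 'a \<times> 'o, 'p) arrow1" where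
  "F \<equiv> kleisli_arrow P X \<phi>"

abbreviation weak_\<phi> :: "'o \<Rightarrow> 'p" where
  "weak_\<phi> A \<equiv> Reidx P (Pr1 P X A) \<phi>"

sublocale K: primary_doctrine K
  by (rule kleisli_primary)

section \<open>The Kleisli data in terms of \<open>P\<close>\<close>

lemma kleisli_simps [simp]:
  "Obj K = Obj P"
  "Dom K (A, g, B) = A"
  "Cod K (A, g, B) = B"
  "Id K A = (A, Pr2 P X A, A)"
  "Comp K (B', h, D) (A, g, B) = (A, h \<cdot> \<langle>Pr1 P X A, g\<rangle>, D)"
  "Prod K A B = A \<boxtimes> B"
  "Pr1 K A B = (A \<boxtimes> B, Pr1 P A B \<cdot> Pr2 P X (A \<boxtimes> B), A)"
  "Pr2 K A B = (A \<boxtimes> B, Pr2 P A B \<cdot> Pr2 P X (A \<boxtimes> B), B)"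
  "Fib K A = down (Fib P (X \<boxtimes> A)) (weak_\<phi> A)"
  "Reidx K (A, g, B) = Reidx P \<langle>Pr1 P X A, g\<rangle>"
  by (simp_all add: kleisli_doctrine_def kleisli_cat_def fp_cat.defs doctrine.defs down_def)

lemma kleisli_Arr_iff [simp]:
  "(A, g, B) \<in> Arr K \<longleftrightarrow> A \<in> Obj P \<and> B \<in> Obj P \<and> g \<in> Arr P \<and> Dom P g = X \<boxtimes> A \<and> Cod P g = B"
  by (simp add: kleisli_doctrine_def kleisli_cat_def fp_cat.defs doctrine.defs Hom_iff)

lemma kleisli_Hom_cases:
  assumes "f \<in> Hom K A B"
  obtains g where "f = (A, g, B)" "A \<in> Obj P" "B \<in> Obj P" "g \<in> Arr P" "Dom P g = X \<boxtimes> A" "Cod P g = B"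
  using assms by (cases f) (auto simp: Hom_iff)

text \<open>Tupling is a definite description, so it is computed through the universal property in
  \<open>K\<close>: the proposed arrow has the right composites with the two projections.\<close>

lemma kleisli_tuple [simp]:
  assumes "f \<in> Arr P" "g \<in> Arr P" "Dom P f = X \<boxtimes> A" "Dom P g = X \<boxtimes> A" "Cod P f = B" "Cod P g = B'"
    "A \<in> Obj P"
  shows "\<langle>(A, f, B), (A, g, B')\<rangle>\<^bsub>K\<^esub> = (A, \<langle>f, g\<rangle>, B \<boxtimes> B')"
proof -
  have "B \<in> Obj P" "B' \<in> Obj P" using assms by auto
  then show ?thesis
    using assms by (intro K.tuple_eqI[of _ B B']) auto
qed

lemma kleisli_times_id:
  assumes "f \<in> Arr P" "A \<in> Obj P" "Dom P f = X \<boxtimes> A" "Cod P f = A'" "B \<in> Obj P"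
  shows "times_id K (A, f, A') B = (A \<boxtimes> B,
    \<langle>f \<cdot> \<langle>Pr1 P X (A \<boxtimes> B), Pr1 P A B \<cdot> Pr2 P X (A \<boxtimes> B)\<rangle>, Pr2 P A B \<cdot> Pr2 P X (A \<boxtimes> B)\<rangle>, A' \<boxtimes> B)"
  using assms by (simp add: times_id_def)

lemma kleisli_arrow_simps [simp]:
  "ob F A = A"
  "ar F f = (Dom P f, f \<cdot> Pr2 P X (Dom P f), Cod P f)"
  "fib F A \<alpha> = weak_\<phi> A \<sqinter>\<^bsub>Fib P (X \<boxtimes> A)\<^esub> Reidx P (Pr2 P X A) \<alpha>"
  by (simp_all add: kleisli_arrow_def)

lemma kleisli_top [simp]: "A \<in> Obj P \<Longrightarrow> \<top>\<^bsub>down (Fib P (X \<boxtimes> A)) (weak_\<phi> A)\<^esub> = weak_\<phi> A"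
  by (intro meet_top.down_top Fib_meet_top) simp_all

lemma kleisli_meet:
  assumes "A \<in> Obj P" "\<alpha> \<in> carrier (Fib K A)" "\<beta> \<in> carrier (Fib K A)"
  shows "\<alpha> \<sqinter>\<^bsub>Fib K A\<^esub> \<beta> = \<alpha> \<sqinter>\<^bsub>Fib P (X \<boxtimes> A)\<^esub> \<beta>"
  using assms unfolding kleisli_simps by (intro meet_top.down_meet Fib_meet_top) simp_all

text \<open>A predicate \<open>\<alpha>\<close> in the Kleisli fiber over \<open>A\<close> lives
  over \<open>X \<times> A\<close>, hence substitution is an instance of
  \<open>fibered_equality_subst\<close> with the \<open>X\<close> coordinate as parameter. The
  product axiom is that of \<open>P\<close> weakened by \<open>X\<close>, with the truncations
  handled by \<open>meet_meet_le\<close>.\<close>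

lemma kleisli_fibered_equality:
  assumes \<delta>: "fibered_equality P \<delta>"
  shows "fibered_equality K (\<lambda>A. fib F (A \<boxtimes> A) (\<delta> A))"
proof -
  have \<delta>_closed [simp]: "\<delta> A \<in> carrier (Fib P (A \<boxtimes> A))" if "A \<in> Obj P" for A
    using \<delta> that by (simp add: fibered_equality_def)
  have meet_le: "\<alpha> \<sqinter>\<^bsub>Fib P A\<^esub> \<beta> \<sqsubseteq>\<^bsub>Fib P A\<^esub> \<alpha>"
    if "A \<in> Obj P" "\<alpha> \<in> carrier (Fib P A)" "\<beta> \<in> carrier (Fib P A)" for A \<alpha> \<beta>
  proof -
    interpret meet_top "Fib P A" using that by (intro Fib_meet_top)
    show ?thesis using that by (intro meet_left)
  qed
  have closed: "fib F (A \<boxtimes> A) (\<delta> A) \<in> carrier (Fib K (A \<boxtimes> A))" if "A \<in> Obj P" for A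
    using that by (auto intro: meet_le)
  have refl: "\<top>\<^bsub>Fib K A\<^esub> \<sqsubseteq>\<^bsub>Fib K A\<^esub> Reidx K \<langle>Id K A, Id K A\<rangle>\<^bsub>K\<^esub> (fib F (A \<boxtimes> A) (\<delta> A))"
    if [simp]: "A \<in> Obj P" for A
  proof -
    interpret meet_top "Fib P (X \<boxtimes> A)" by (intro Fib_meet_top) simp
    show ?thesis by (simp add: fibered_equality_refl[OF \<delta>] le_meet_iff)
  qed
  have subst: "Reidx K (Pr1 K A A) \<alpha> \<sqinter>\<^bsub>Fib K (A \<boxtimes> A)\<^esub> fib F (A \<boxtimes> A) (\<delta> A)
      \<sqsubseteq>\<^bsub>Fib K (A \<boxtimes> A)\<^esub> Reidx K (Pr2 K A A) \<alpha>"
    if [simp]: "A \<in> Obj P" and \<alpha>: "\<alpha> \<in> carrier (Fib K A)" for A \<alpha>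
  proof -
    let ?Z = "X \<boxtimes> A \<boxtimes> A"
    interpret meet_top "Fib P ?Z" by (intro Fib_meet_top) simp
    have [simp]: "\<alpha> \<in> carrier (Fib P (X \<boxtimes> A))" using \<alpha> by simp
    have closed1: "Reidx K (Pr1 K A A) \<alpha> \<in> carrier (Fib K (A \<boxtimes> A))"
      by (rule K.Reidx_in_carrier) (use \<alpha> in simp_all)
    \<comment> \<open>Forgetting the truncation enlarges the left side and gives it the shape of
      \<open>fibered_equality_subst\<close>.\<close>
    have drop: "Reidx K (Pr1 K A A) \<alpha> \<sqinter>\<^bsub>Fib P ?Z\<^esub> fib F (A \<boxtimes> A) (\<delta> A)
        \<sqsubseteq>\<^bsub>Fib P ?Z\<^esub> Reidx K (Pr1 K A A) \<alpha> \<sqinter>\<^bsub>Fib P ?Z\<^esub> Reidx P (Pr2 P X (A \<boxtimes> A)) (\<delta> A)"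
      by (intro meet_mono) (simp_all add: meet_right)
    have "Reidx K (Pr1 K A A) \<alpha> \<sqinter>\<^bsub>Fib P ?Z\<^esub> Reidx P (Pr2 P X (A \<boxtimes> A)) (\<delta> A)
        \<sqsubseteq>\<^bsub>Fib P ?Z\<^esub> Reidx K (Pr2 K A A) \<alpha>"
      using fibered_equality_subst[OF \<delta>, of "Pr1 P X (A \<boxtimes> A)" "Pr1 P A A \<cdot> Pr2 P X (A \<boxtimes> A)"
          "Pr2 P A A \<cdot> Pr2 P X (A \<boxtimes> A)" ?Z X A \<alpha>] by simp
    then have "Reidx K (Pr1 K A A) \<alpha> \<sqinter>\<^bsub>Fib P ?Z\<^esub> fib F (A \<boxtimes> A) (\<delta> A)
        \<sqsubseteq>\<^bsub>Fib P ?Z\<^esub> Reidx K (Pr2 K A A) \<alpha>"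
      by (rule le_trans[OF drop]) simp_all
    then show ?thesis
      unfolding kleisli_meet[OF _ closed1 closed, OF Prod_in_Obj, OF that(1) that(1) that(1)]
      by (simp only: kleisli_simps down_simps)
  qed
  have prod: "Reidx K \<langle>p1, p3\<rangle>\<^bsub>K\<^esub> (fib F (A \<boxtimes> A) (\<delta> A)) \<sqinter>\<^bsub>Fib K (Q \<boxtimes> Q)\<^esub> Reidx K \<langle>p2, p4\<rangle>\<^bsub>K\<^esub> (fib F (B \<boxtimes> B) (\<delta> B))
      \<sqsubseteq>\<^bsub>Fib K (Q \<boxtimes> Q)\<^esub> fib F (Q \<boxtimes> Q) (\<delta> Q)"
    if [simp]: "A \<in> Obj P" "B \<in> Obj P" and Q: "Q = A \<boxtimes> B"
      and p: "p1 = Pr1 K A B \<cdot>\<^bsub>K\<^esub> Pr1 K Q Q" "p2 = Pr2 K A B \<cdot>\<^bsub>K\<^esub> Pr1 K Q Q"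
        "p3 = Pr1 K A B \<cdot>\<^bsub>K\<^esub> Pr2 K Q Q" "p4 = Pr2 K A B \<cdot>\<^bsub>K\<^esub> Pr2 K Q Q"
    for A B Q p1 p2 p3 p4
  proof -
    let ?Z = "X \<boxtimes> Q \<boxtimes> Q"
    have Q_Obj [simp]: "Q \<in> Obj P" by (simp add: Q)
    have AB [simp]: "A \<boxtimes> B = Q" by (simp add: Q)
    have Pr_AB [simp]: "Dom P (Pr1 P A B) = Q" "Dom P (Pr2 P A B) = Q" by simp_all
    interpret meet_top "Fib P ?Z" by (intro Fib_meet_top) simp
    define q where "q = \<langle>Pr1 P A B \<cdot> Pr1 P Q Q, Pr1 P A B \<cdot> Pr2 P Q Q\<rangle>"
    define r where "r = \<langle>Pr2 P A B \<cdot> Pr1 P Q Q, Pr2 P A B \<cdot> Pr2 P Q Q\<rangle>"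
    have qr [simp]: "q \<in> Arr P" "Dom P q = Q \<boxtimes> Q" "Cod P q = A \<boxtimes> A"
        "r \<in> Arr P" "Dom P r = Q \<boxtimes> Q" "Cod P r = B \<boxtimes> B"
      by (simp_all add: q_def r_def)
    have pK: "\<langle>p1, p3\<rangle>\<^bsub>K\<^esub> = (Q \<boxtimes> Q, q \<cdot> Pr2 P X (Q \<boxtimes> Q), A \<boxtimes> A)"
        "\<langle>p2, p4\<rangle>\<^bsub>K\<^esub> = (Q \<boxtimes> Q, r \<cdot> Pr2 P X (Q \<boxtimes> Q), B \<boxtimes> B)"
      by (simp_all add: p q_def r_def)
    have "Reidx P q (\<delta> A) \<sqinter>\<^bsub>Fib P (Q \<boxtimes> Q)\<^esub> Reidx P r (\<delta> B) \<sqsubseteq>\<^bsub>Fib P (Q \<boxtimes> Q)\<^esub> \<delta> Q"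
      using \<delta> that(1,2) unfolding fibered_equality_def q_def r_def Q Let_def by blast
    then have "Reidx P (Pr2 P X (Q \<boxtimes> Q)) (Reidx P q (\<delta> A) \<sqinter>\<^bsub>Fib P (Q \<boxtimes> Q)\<^esub> Reidx P r (\<delta> B))
        \<sqsubseteq>\<^bsub>Fib P ?Z\<^esub> Reidx P (Pr2 P X (Q \<boxtimes> Q)) (\<delta> Q)"
      by (intro Reidx_le[of "Pr2 P X (Q \<boxtimes> Q)"]) auto
    then have le: "Reidx P (q \<cdot> Pr2 P X (Q \<boxtimes> Q)) (\<delta> A) \<sqinter>\<^bsub>Fib P ?Z\<^esub> Reidx P (r \<cdot> Pr2 P X (Q \<boxtimes> Q)) (\<delta> B)
        \<sqsubseteq>\<^bsub>Fib P ?Z\<^esub> Reidx P (Pr2 P X (Q \<boxtimes> Q)) (\<delta> Q)"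
      by simp
    have F: "Reidx K \<langle>p1, p3\<rangle>\<^bsub>K\<^esub> (fib F (A \<boxtimes> A) (\<delta> A)) = weak_\<phi> (Q \<boxtimes> Q) \<sqinter>\<^bsub>Fib P ?Z\<^esub> Reidx P (q \<cdot> Pr2 P X (Q \<boxtimes> Q)) (\<delta> A)"
      "Reidx K \<langle>p2, p4\<rangle>\<^bsub>K\<^esub> (fib F (B \<boxtimes> B) (\<delta> B)) = weak_\<phi> (Q \<boxtimes> Q) \<sqinter>\<^bsub>Fib P ?Z\<^esub> Reidx P (r \<cdot> Pr2 P X (Q \<boxtimes> Q)) (\<delta> B)"
      by (simp_all add: pK)
    have "Reidx K \<langle>p1, p3\<rangle>\<^bsub>K\<^esub> (fib F (A \<boxtimes> A) (\<delta> A)) \<in> carrier (Fib K (Q \<boxtimes> Q))"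
      "Reidx K \<langle>p2, p4\<rangle>\<^bsub>K\<^esub> (fib F (B \<boxtimes> B) (\<delta> B)) \<in> carrier (Fib K (Q \<boxtimes> Q))"
      unfolding F by (simp_all add: meet_left)
    then have "Reidx K \<langle>p1, p3\<rangle>\<^bsub>K\<^esub> (fib F (A \<boxtimes> A) (\<delta> A)) \<sqinter>\<^bsub>Fib K (Q \<boxtimes> Q)\<^esub> Reidx K \<langle>p2, p4\<rangle>\<^bsub>K\<^esub> (fib F (B \<boxtimes> B) (\<delta> B))
      = Reidx K \<langle>p1, p3\<rangle>\<^bsub>K\<^esub> (fib F (A \<boxtimes> A) (\<delta> A)) \<sqinter>\<^bsub>Fib P ?Z\<^esub> Reidx K \<langle>p2, p4\<rangle>\<^bsub>K\<^esub> (fib F (B \<boxtimes> B) (\<delta> B))"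
      by (intro kleisli_meet) simp_all
    also have "\<dots> \<sqsubseteq>\<^bsub>Fib P ?Z\<^esub> fib F (Q \<boxtimes> Q) (\<delta> Q)"
      unfolding F unfolding kleisli_arrow_simps by (rule meet_meet_le[OF _ _ _ _ le]) simp_all
    finally show ?thesis by (simp only: kleisli_simps down_simps)
  qed
  show ?thesis
    unfolding fibered_equality_def Let_def
    using closed refl subst prod by (simp only: kleisli_simps(1,6)) blast
qed

text \<open>Reduces Beck--Chevalley in \<open>K\<close> along \<open>f\<close> to Beck--Chevalley in
  \<open>P\<close> along \<open>\<langle>Pr1 P X A, f\<rangle>\<close>: up to reassociation,
  \<open>f \<times> id\<close> in \<open>K\<close> is this arrow times the identity of
  \<open>B\<close>.\<close>

lemma kleisli_Reidx_times_id:
  assumes "f \<in> Arr P" "A \<in> Obj P" "Dom P f = X \<boxtimes> A" "Cod P f = A'" "B \<in> Obj P"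
    "\<alpha> \<in> carrier (Fib P (X \<boxtimes> A' \<boxtimes> B))"
  shows "Reidx P (assoc_inv X A B) (Reidx K (times_id K (A, f, A') B) \<alpha>)
    = Reidx P (times_id P \<langle>Pr1 P X A, f\<rangle> B) (Reidx P (assoc_inv X A' B) \<alpha>)"
proof -
  have "A' \<in> Obj P" using assms by auto
  then show ?thesis
    using assms by (simp add: kleisli_times_id) (simp add: assoc_inv_def times_id_def)
qed

text \<open>Combined with \<open>Reidx_iso_le_iff\<close>, this turns the adjunction of
  \<open>P\<close> in context \<open>X \<times> C\<close> into one of \<open>K\<close> in context
  \<open>C\<close>.\<close>

lemma kleisli_Reidx_Pr1:
  assumes "B \<in> Obj P" "C \<in> Obj P" "\<beta> \<in> carrier (Fib P (X \<boxtimes> C))"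
  shows "Reidx K (Pr1 K C B) \<beta> = Reidx P (assoc X C B) (Reidx P (Pr1 P (X \<boxtimes> C) B) \<beta>)"
  using assms by (simp add: assoc_def)

text \<open>The context \<open>C\<close> of \<open>K\<close> is the context
  \<open>X \<times> C\<close> of \<open>P\<close>; Frobenius and Beck--Chevalley are then those of
  \<open>P\<close> after reassociation.\<close>

lemma kleisli_existential_quantifier:
  assumes E: "existential_quantifier P E"
  shows "existential_quantifier K (\<lambda>B C \<alpha>. E B (X \<boxtimes> C) (Reidx P (assoc_inv X C B) \<alpha>))"
proof -
  let ?E = "\<lambda>B C \<alpha>. E B (X \<boxtimes> C) (Reidx P (assoc_inv X C B) \<alpha>)"
  have closed: "?E B C \<alpha> \<in> carrier (Fib P (X \<boxtimes> C))"
    if "B \<in> Obj P" "C \<in> Obj P" "\<alpha> \<in> carrier (Fib P (X \<boxtimes> C \<boxtimes> B))" for B C \<alpha>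
    using that by (intro existential_quantifier_closed[OF E]) simp_all
  have le_iff: "?E B C \<alpha> \<sqsubseteq>\<^bsub>Fib P (X \<boxtimes> C)\<^esub> \<beta> \<longleftrightarrow> \<alpha> \<sqsubseteq>\<^bsub>Fib P (X \<boxtimes> C \<boxtimes> B)\<^esub> Reidx K (Pr1 K C B) \<beta>"
    if "B \<in> Obj P" "C \<in> Obj P" "\<alpha> \<in> carrier (Fib P (X \<boxtimes> C \<boxtimes> B))" "\<beta> \<in> carrier (Fib P (X \<boxtimes> C))"
    for B C \<alpha> \<beta>
  proof -
    have "?E B C \<alpha> \<sqsubseteq>\<^bsub>Fib P (X \<boxtimes> C)\<^esub> \<beta>
        \<longleftrightarrow> Reidx P (assoc_inv X C B) \<alpha> \<sqsubseteq>\<^bsub>Fib P ((X \<boxtimes> C) \<boxtimes> B)\<^esub> Reidx P (Pr1 P (X \<boxtimes> C) B) \<beta>"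
      using that by (intro existential_quantifier_le_iff[OF E]) simp_all
    also have "\<dots> \<longleftrightarrow> \<alpha> \<sqsubseteq>\<^bsub>Fib P (X \<boxtimes> C \<boxtimes> B)\<^esub> Reidx P (assoc X C B) (Reidx P (Pr1 P (X \<boxtimes> C) B) \<beta>)"
      by (rule Reidx_iso_le_iff) (use that in \<open>simp_all add: assoc_inverse\<close>)
    finally show ?thesis
      using that by (simp only: kleisli_Reidx_Pr1)
  qed
  \<comment> \<open>Why no truncation appears: the bound on \<open>\<alpha>\<close> is the weakening
    of \<open>weak_\<phi> C\<close>, so the adjunction itself puts \<open>?E B C \<alpha>\<close>
    below \<open>weak_\<phi> C\<close>. The term \<open>Reidx K (Pr1 K C B)\<close> is kept folded
    for \<open>le_iff\<close> to match.\<close>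
  have closed_K: "?E B C \<alpha> \<in> carrier (Fib K C)"
    if "B \<in> Obj P" "C \<in> Obj P" "\<alpha> \<in> carrier (Fib K (Prod K C B))" for B C \<alpha>
  proof -
    have "weak_\<phi> (C \<boxtimes> B) = Reidx K (Pr1 K C B) (weak_\<phi> C)"
      using that by simp
    then show ?thesis
      using that by (simp add: closed le_iff del: kleisli_simps(7,10))
  qed
  have galois: "galois_connection \<lparr>orderA = Fib K (Prod K C B), orderB = Fib K C, lower = ?E B C,
      upper = Reidx K (Pr1 K C B)\<rparr>"
    if [simp]: "B \<in> Obj P" "C \<in> Obj P" for B C
  proof (intro galois_connection.intro connection.intro galois_connection_axioms.intro,
      simp_all only: galcon.simps)
    show "partial_order (Fib K (Prod K C B))" "partial_order (Fib K C)"
      by (rule K.Fib_po; simp)+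
    show "Reidx K (Pr1 K C B) \<in> carrier (Fib K C) \<rightarrow> carrier (Fib K (Prod K C B))"
      by (rule K.Reidx_closed) (simp add: Hom_iff)
    show "?E B C \<in> carrier (Fib K (Prod K C B)) \<rightarrow> carrier (Fib K C)"
      by (intro funcsetI closed_K that)
    show "?E B C \<alpha> \<sqsubseteq>\<^bsub>Fib K C\<^esub> \<beta> \<longleftrightarrow> \<alpha> \<sqsubseteq>\<^bsub>Fib K (Prod K C B)\<^esub> Reidx K (Pr1 K C B) \<beta>"
      if "\<alpha> \<in> carrier (Fib K (Prod K C B))" "\<beta> \<in> carrier (Fib K C)" for \<alpha> \<beta>
      using that by (simp add: le_iff del: kleisli_simps(7,10))
  qed
  have BC: "?E B C (Reidx K (times_id K f B) \<alpha>) = Reidx K f (?E B C' \<alpha>)"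
    if "B \<in> Obj P" "f \<in> Hom K C C'" "\<alpha> \<in> carrier (Fib K (Prod K C' B))" for B C C' f \<alpha>
    using that(2)
  proof (cases rule: kleisli_Hom_cases)
    case (1 g)
    have "Reidx K f (?E B C' \<alpha>)
        = E B (X \<boxtimes> C) (Reidx P (times_id P \<langle>Pr1 P X C, g\<rangle> B) (Reidx P (assoc_inv X C' B) \<alpha>))"
      unfolding 1(1) kleisli_simps
      by (rule existential_quantifier_Reidx[OF E]) (use that 1 in simp_all)
    also have "\<dots> = ?E B C (Reidx K (times_id K f B) \<alpha>)"
      unfolding 1(1) by (subst kleisli_Reidx_times_id) (use that 1 in simp_all)
    finally show ?thesis by (rule sym)
  qed
  have Frobenius: "?E B C (\<alpha> \<sqinter>\<^bsub>Fib K (Prod K C B)\<^esub> Reidx K (Pr1 K C B) \<beta>) = ?E B C \<alpha> \<sqinter>\<^bsub>Fib K C\<^esub> \<beta>"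
    if [simp]: "B \<in> Obj P" "C \<in> Obj P" and \<alpha>: "\<alpha> \<in> carrier (Fib K (Prod K C B))" and \<beta>: "\<beta> \<in> carrier (Fib K C)"
    for B C \<alpha> \<beta>
  proof -
    have [simp]: "\<alpha> \<in> carrier (Fib P (X \<boxtimes> C \<boxtimes> B))" "\<beta> \<in> carrier (Fib P (X \<boxtimes> C))"
      using \<alpha> \<beta> by simp_all
    have 1: "Reidx K (Pr1 K C B) \<beta> \<in> carrier (Fib K (Prod K C B))"
      by (rule K.Reidx_in_carrier) (use \<beta> in simp_all)
    have "\<alpha> \<sqinter>\<^bsub>Fib K (Prod K C B)\<^esub> Reidx K (Pr1 K C B) \<beta> = \<alpha> \<sqinter>\<^bsub>Fib P (X \<boxtimes> C \<boxtimes> B)\<^esub> Reidx K (Pr1 K C B) \<beta>"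
      using \<alpha> 1 unfolding kleisli_simps(6) by (intro kleisli_meet) simp_all
    moreover have "?E B C \<alpha> \<sqinter>\<^bsub>Fib K C\<^esub> \<beta> = ?E B C \<alpha> \<sqinter>\<^bsub>Fib P (X \<boxtimes> C)\<^esub> \<beta>"
      by (rule kleisli_meet[OF _ closed_K \<beta>]) (use \<alpha> in simp_all)
    moreover have "Reidx P (assoc_inv X C B) (\<alpha> \<sqinter>\<^bsub>Fib P (X \<boxtimes> C \<boxtimes> B)\<^esub> Reidx K (Pr1 K C B) \<beta>)
        = Reidx P (assoc_inv X C B) \<alpha> \<sqinter>\<^bsub>Fib P ((X \<boxtimes> C) \<boxtimes> B)\<^esub> Reidx P (Pr1 P (X \<boxtimes> C) B) \<beta>"
      by (simp add: assoc_inv_def)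
    ultimately show ?thesis
      using existential_quantifier_Frobenius[OF E, of B "X \<boxtimes> C" "Reidx P (assoc_inv X C B) \<alpha>" \<beta>]
      by (simp only: Reidx_in_carrier assoc_typing Prod_in_Obj X_in_Obj that \<open>\<alpha> \<in> carrier (Fib P (X \<boxtimes> C \<boxtimes> B))\<close> \<open>\<beta> \<in> carrier (Fib P (X \<boxtimes> C))\<close>)
  qed
  show ?thesis
    unfolding existential_quantifier_def
    using galois BC Frobenius by (simp only: kleisli_simps(1)) blast
qed

text \<open>The right adjoint of \<open>P\<close> can leave the Kleisli fiber. Meeting it with
  \<open>weak_\<phi> C\<close> brings it back and does not disturb the adjunction, since the
  elements compared with it already lie below \<open>weak_\<phi> C\<close>.\<close>

lemma kleisli_universal_quantifier:
  assumes U: "universal_quantifier P U"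
  shows "universal_quantifier K
    (\<lambda>B C \<alpha>. U B (X \<boxtimes> C) (Reidx P (assoc_inv X C B) \<alpha>) \<sqinter>\<^bsub>Fib P (X \<boxtimes> C)\<^esub> weak_\<phi> C)"
proof -
  let ?U = "\<lambda>B C \<alpha>. U B (X \<boxtimes> C) (Reidx P (assoc_inv X C B) \<alpha>)"
  let ?V = "\<lambda>B C \<alpha>. ?U B C \<alpha> \<sqinter>\<^bsub>Fib P (X \<boxtimes> C)\<^esub> weak_\<phi> C"
  have closed: "?U B C \<alpha> \<in> carrier (Fib P (X \<boxtimes> C))"
    if "B \<in> Obj P" "C \<in> Obj P" "\<alpha> \<in> carrier (Fib P (X \<boxtimes> C \<boxtimes> B))" for B C \<alpha>
    using that by (intro universal_quantifier_closed[OF U]) simp_all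
  have le_iff: "\<beta> \<sqsubseteq>\<^bsub>Fib P (X \<boxtimes> C)\<^esub> ?U B C \<alpha> \<longleftrightarrow> Reidx K (Pr1 K C B) \<beta> \<sqsubseteq>\<^bsub>Fib P (X \<boxtimes> C \<boxtimes> B)\<^esub> \<alpha>"
    if "B \<in> Obj P" "C \<in> Obj P" "\<alpha> \<in> carrier (Fib P (X \<boxtimes> C \<boxtimes> B))" "\<beta> \<in> carrier (Fib P (X \<boxtimes> C))"
    for B C \<alpha> \<beta>
  proof -
    have "\<beta> \<sqsubseteq>\<^bsub>Fib P (X \<boxtimes> C)\<^esub> ?U B C \<alpha>
        \<longleftrightarrow> Reidx P (Pr1 P (X \<boxtimes> C) B) \<beta> \<sqsubseteq>\<^bsub>Fib P ((X \<boxtimes> C) \<boxtimes> B)\<^esub> Reidx P (assoc_inv X C B) \<alpha>"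
      using that by (intro le_universal_quantifier_iff[OF U]) simp_all
    also have "\<dots> \<longleftrightarrow> Reidx P (assoc X C B) (Reidx P (Pr1 P (X \<boxtimes> C) B) \<beta>) \<sqsubseteq>\<^bsub>Fib P (X \<boxtimes> C \<boxtimes> B)\<^esub> \<alpha>"
      by (rule Reidx_iso_le_iff[symmetric]) (use that in \<open>simp_all add: assoc_inverse\<close>)
    finally show ?thesis
      using that by (simp only: kleisli_Reidx_Pr1)
  qed
  have galois: "galois_connection \<lparr>orderA = Fib K C, orderB = Fib K (Prod K C B),
      lower = Reidx K (Pr1 K C B), upper = ?V B C\<rparr>"
    if [simp]: "B \<in> Obj P" "C \<in> Obj P" for B C
  proof (intro galois_connection.intro connection.intro galois_connection_axioms.intro,
      simp_all only: galcon.simps)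
    interpret meet_top "Fib P (X \<boxtimes> C)" by (intro Fib_meet_top) simp
    show "partial_order (Fib K (Prod K C B))" "partial_order (Fib K C)"
      by (rule K.Fib_po; simp)+
    show "Reidx K (Pr1 K C B) \<in> carrier (Fib K C) \<rightarrow> carrier (Fib K (Prod K C B))"
      by (rule K.Reidx_closed) (simp add: Hom_iff)
    show "?V B C \<in> carrier (Fib K (Prod K C B)) \<rightarrow> carrier (Fib K C)"
      by (auto simp: closed meet_right)
    show "Reidx K (Pr1 K C B) \<alpha> \<sqsubseteq>\<^bsub>Fib K (Prod K C B)\<^esub> \<beta> \<longleftrightarrow> \<alpha> \<sqsubseteq>\<^bsub>Fib K C\<^esub> ?V B C \<beta>"
      if "\<beta> \<in> carrier (Fib K (Prod K C B))" "\<alpha> \<in> carrier (Fib K C)" for \<alpha> \<beta>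
      using that by (simp add: le_iff le_meet_iff closed del: kleisli_simps(7,10))
  qed
  have BC: "Reidx K f (?V B C' \<alpha>) = ?V B C (Reidx K (times_id K f B) \<alpha>)"
    if "B \<in> Obj P" "f \<in> Hom K C C'" "\<alpha> \<in> carrier (Fib K (Prod K C' B))" for B C C' f \<alpha>
    using that(2)
  proof (cases rule: kleisli_Hom_cases)
    case (1 g)
    have "Reidx K f (?U B C' \<alpha>)
        = U B (X \<boxtimes> C) (Reidx P (times_id P \<langle>Pr1 P X C, g\<rangle> B) (Reidx P (assoc_inv X C' B) \<alpha>))"
      unfolding 1(1) kleisli_simps
      by (rule universal_quantifier_Reidx[OF U]) (use that 1 in simp_all)
    also have "\<dots> = ?U B C (Reidx K (times_id K f B) \<alpha>)"
      unfolding 1(1) by (subst kleisli_Reidx_times_id) (use that 1 in simp_all)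
    finally have "Reidx K f (?U B C' \<alpha>) = ?U B C (Reidx K (times_id K f B) \<alpha>)" .
    \<comment> \<open>Kleisli reindexing leaves the \<open>X\<close> coordinate alone, so it carries
      \<open>weak_\<phi> C'\<close> to \<open>weak_\<phi> C\<close>.\<close>
    moreover have "Reidx K f (?V B C' \<alpha>) = Reidx K f (?U B C' \<alpha>) \<sqinter>\<^bsub>Fib P (X \<boxtimes> C)\<^esub> weak_\<phi> C"
      using that 1 closed[of B C' \<alpha>] by simp
    ultimately show ?thesis by (simp only:)
  qed
  show ?thesis
    unfolding universal_quantifier_def
    using galois BC by (simp only: kleisli_simps(1)) blast
qed

section \<open>Inheritance of each structure by the Kleisli doctrine\<close>

lemma kleisli_elementary: "elementary P \<Longrightarrow> elementary K"
  using kleisli_fibered_equality kleisli_primary unfolding elementary_def primary_iff by blast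

lemma kleisli_existential: "existential P \<Longrightarrow> existential K"
  using kleisli_existential_quantifier kleisli_primary unfolding existential_def primary_iff by blast

lemma kleisli_universal: "universal P \<Longrightarrow> universal K"
  using kleisli_universal_quantifier K.doctrine_axioms unfolding universal_def by blast

text \<open>A Kleisli implication is a truncated implication of \<open>P\<close>. Reindexing along
  \<open>\<langle>Pr1 P X A, g\<rangle>\<close> preserves the implication and takes the truncation
  over \<open>B\<close> to the one over \<open>A\<close>.\<close>

lemma kleisli_implicational:
  assumes P: "implicational P"
  shows "implicational K"
  unfolding implicational_def
proof (intro conjI allI ballI)
  show "primary K" using kleisli_primary by (simp add: primary_iff)
  have cc: "cartesian_closed_poset (Fib P A)" if "A \<in> Obj P" for A
    using P that by (simp add: implicational_def)
  show "cartesian_closed_poset (Fib K A)" if "A \<in> Obj K" for A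
    using that by (simp add: down_cartesian_closed(1)[OF cc])
  show "preserves_imp (Fib K B) (Fib K A) (Reidx K f)" if "f \<in> Hom K A B" for A B f
    using that
  proof (cases rule: kleisli_Hom_cases)
    case (1 g)
    let ?h = "\<langle>Pr1 P X A, g\<rangle>"
    have "?h \<in> Hom P (X \<boxtimes> A) (X \<boxtimes> B)" using 1 by (simp add: Hom_iff)
    then have pres: "preserves_imp (Fib P (X \<boxtimes> B)) (Fib P (X \<boxtimes> A)) (Reidx P ?h)"
      using P unfolding implicational_def by blast
    show ?thesis
      unfolding preserves_imp_def
    proof (intro ballI)
      fix x y assume x: "x \<in> carrier (Fib K B)" and y: "y \<in> carrier (Fib K B)"
      have fxy: "Reidx K f x \<in> carrier (Fib K A)" "Reidx K f y \<in> carrier (Fib K A)"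
        by (rule K.Reidx_in_carrier; use 1 x y in simp)+
      have "imp (Fib K A) (Reidx K f x) (Reidx K f y)
          = imp (Fib P (X \<boxtimes> A)) (Reidx P ?h x) (Reidx P ?h y) \<sqinter>\<^bsub>Fib P (X \<boxtimes> A)\<^esub> weak_\<phi> A"
        using fxy 1 by (simp add: down_cartesian_closed(2)[OF cc])
      moreover have "imp (Fib K B) x y = imp (Fib P (X \<boxtimes> B)) x y \<sqinter>\<^bsub>Fib P (X \<boxtimes> B)\<^esub> weak_\<phi> B"
        using x y 1 by (simp add: down_cartesian_closed(2)[OF cc])
      moreover have "imp (Fib P (X \<boxtimes> B)) x y \<in> carrier (Fib P (X \<boxtimes> B))"
        using x y 1 by (simp add: imp_closed[OF cc])
      ultimately show "Reidx K f (imp (Fib K B) x y) = imp (Fib K A) (Reidx K f x) (Reidx K f y)"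
        using pres x y 1 by (simp add: preserves_imp_def)
    qed
  qed
qed

lemma kleisli_bounded:
  assumes P: "bounded_doctrine P"
  shows "bounded_doctrine K"
  unfolding bounded_doctrine_def
proof (intro conjI allI ballI)
  show "doctrine K" by (rule K.doctrine_axioms)
  have bot: "weak_partial_order_bottom (Fib P A)" if "A \<in> Obj P" for A
    using P that by (simp add: bounded_doctrine_def)
  show "weak_partial_order_top (Fib K A)" if "A \<in> Obj K" for A
    using K.Fib_meet_top[OF that] by (simp add: meet_top_def)
  show "weak_partial_order_bottom (Fib K A)" if "A \<in> Obj K" for A
    using that by (simp add: meet_top.down_bottom(1)[OF Fib_meet_top bot])
  show "preserves_top (Fib K B) (Fib K A) (Reidx K f)" if "f \<in> Hom K A B" for A B f
    by (rule K.Reidx_Hom_top[OF that])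
  show "preserves_bottom (Fib K B) (Fib K A) (Reidx K f)" if "f \<in> Hom K A B" for A B f
    using that
  proof (cases rule: kleisli_Hom_cases)
    case (1 g)
    then have "\<langle>Pr1 P X A, g\<rangle> \<in> Hom P (X \<boxtimes> A) (X \<boxtimes> B)" by (simp add: Hom_iff)
    then have "preserves_bottom (Fib P (X \<boxtimes> B)) (Fib P (X \<boxtimes> A)) (Reidx P \<langle>Pr1 P X A, g\<rangle>)"
      using P unfolding bounded_doctrine_def by blast
    then show ?thesis
      using 1 by (simp add: preserves_bottom_def meet_top.down_bottom(2)[OF Fib_meet_top bot])
  qed
qed

lemma kleisli_joins:
  assumes P: "has_binary_joins P"
  shows "has_binary_joins K"
  unfolding has_binary_joins_def
proof (intro conjI allI ballI)
  show "doctrine K" by (rule K.doctrine_axioms)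
  have up: "upper_semilattice (Fib P A)" if "A \<in> Obj P" for A
    using P that by (simp add: has_binary_joins_def)
  show "upper_semilattice (Fib K A)" if "A \<in> Obj K" for A
    using that by (simp add: meet_top.down_join(1)[OF Fib_meet_top up])
  show "preserves_join (Fib K B) (Fib K A) (Reidx K f)" if "f \<in> Hom K A B" for A B f
    using that
  proof (cases rule: kleisli_Hom_cases)
    case (1 g)
    then have "\<langle>Pr1 P X A, g\<rangle> \<in> Hom P (X \<boxtimes> A) (X \<boxtimes> B)" by (simp add: Hom_iff)
    then have pres: "preserves_join (Fib P (X \<boxtimes> B)) (Fib P (X \<boxtimes> A)) (Reidx P \<langle>Pr1 P X A, g\<rangle>)"
      using P unfolding has_binary_joins_def by blast
    have "Reidx K f x \<in> carrier (Fib K A)" if "x \<in> carrier (Fib K B)" for x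
      by (rule K.Reidx_in_carrier) (use 1 that in simp_all)
    then show ?thesis
      using pres 1 by (simp add: preserves_join_def meet_top.down_join(2)[OF Fib_meet_top up])
  qed
qed

end

lemma heyting_algebra_iff:
  "heyting_algebra L \<longleftrightarrow>
    cartesian_closed_poset L \<and> upper_semilattice L \<and> weak_partial_order_bottom L"
  unfolding heyting_algebra_def cartesian_closed_poset_def meet_poset_def bounded_lattice_def lattice_def
  by blast

text \<open>Together with \<open>heyting_arrow_iff\<close> this reduces the Heyting case to
  implication, bounds and joins; the Boolean case then adds only a condition on single
  fibers.\<close>

lemma heyting_iff:
  "heyting P \<longleftrightarrow> implicational P \<and> bounded_doctrine P \<and> has_binary_joins P"
  unfolding heyting_def implicational_def bounded_doctrine_def has_binary_joins_def primary_def
    heyting_algebra_iff cartesian_closed_poset_def meet_poset_def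
  by blast

lemma boolean_iff:
  "boolean P \<longleftrightarrow> heyting P \<and> (\<forall>A\<in>Obj P. boolean_poset (Fib P A))"
  by (simp add: boolean_def boolean_poset_def)

lemma heyting_arrow_iff:
  "heyting_arrow P R M \<longleftrightarrow> implicational_arrow P R M \<and> bounded_arrow P R M \<and> join_arrow P R M"
  unfolding heyting_arrow_def heyting_iff implicational_arrow_def bounded_arrow_def join_arrow_def
    primary_arrow_def implicational_def
  by blast

context kleisli
begin

lemma kleisli_heyting: "heyting P \<Longrightarrow> heyting K"
  by (simp add: heyting_iff kleisli_implicational kleisli_bounded kleisli_joins)

lemma kleisli_boolean:
  assumes "boolean P"
  shows "boolean K"
proof -
  have "heyting_algebra (Fib P A)" "boolean_poset (Fib P A)" if "A \<in> Obj P" for A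
    using assms that by (simp_all add: boolean_iff heyting_def)
  then show ?thesis
    using assms kleisli_heyting by (simp add: boolean_iff down_boolean)
qed

end


section \<open>Extensions of 1-arrows along the Kleisli construction\<close>

text \<open>Interpreted twice, for \<open>G\<close> out of \<open>P\<close> and for
  \<open>G'\<close> out of \<open>K\<close>, so that functoriality and naturality are available for
  both.\<close>

locale doctrine_arrow = P: doctrine P + R: doctrine R
  for P :: "('o, 'a, 'p) doctrine" and R :: "('u, 'b, 'q) doctrine" +
  fixes M :: "('o, 'a, 'p, 'u, 'b, 'q) arrow1"
  assumes is_arrow1: "is_arrow1 P R M"
begin

lemma fp_functor: "fp_functor P R (ob M) (ar M)"
  using is_arrow1 by (simp add: is_arrow1_def)

lemma ob_in_Obj [simp]: "A \<in> Obj P \<Longrightarrow> ob M A \<in> Obj R"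
  using fp_functor by (simp add: fp_functor_def)

lemma ar_typing [simp]:
  assumes "f \<in> Arr P"
  shows "ar M f \<in> Arr R" "Dom R (ar M f) = ob M (Dom P f)" "Cod R (ar M f) = ob M (Cod P f)"
proof -
  have "f \<in> Hom P (Dom P f) (Cod P f)" using assms by (simp add: Hom_iff)
  then have "ar M f \<in> Hom R (ob M (Dom P f)) (ob M (Cod P f))"
    using fp_functor unfolding fp_functor_def by blast
  then show "ar M f \<in> Arr R" "Dom R (ar M f) = ob M (Dom P f)" "Cod R (ar M f) = ob M (Cod P f)"
    by (simp_all add: Hom_iff)
qed

lemma ar_Id: "A \<in> Obj P \<Longrightarrow> ar M (Id P A) = Id R (ob M A)"
  using fp_functor by (simp add: fp_functor_def)

lemma ar_Comp:
  assumes "f \<in> Arr P" "g \<in> Arr P" "Cod P f = Dom P g"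
  shows "ar M (g \<cdot>\<^bsub>P\<^esub> f) = ar M g \<cdot>\<^bsub>R\<^esub> ar M f"
proof -
  have "f \<in> Hom P (Dom P f) (Cod P f)" "g \<in> Hom P (Cod P f) (Cod P g)"
    using assms by (simp_all add: Hom_iff)
  then show ?thesis using fp_functor unfolding fp_functor_def by blast
qed

lemma ar_product:
  "\<lbrakk>A \<in> Obj P; B \<in> Obj P\<rbrakk>
    \<Longrightarrow> is_product R (ob M A) (ob M B) (ob M (A \<boxtimes>\<^bsub>P\<^esub> B)) (ar M (Pr1 P A B)) (ar M (Pr2 P A B))"
  using fp_functor by (simp add: fp_functor_def)

lemma fib_in_carrier [simp]:
  "\<lbrakk>A \<in> Obj P; \<alpha> \<in> carrier (Fib P A)\<rbrakk> \<Longrightarrow> fib M A \<alpha> \<in> carrier (Fib R (ob M A))"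
  using is_arrow1 unfolding is_arrow1_def by blast

lemma fib_Reidx:
  assumes "f \<in> Arr P" "Dom P f = A" "Cod P f = B" "\<alpha> \<in> carrier (Fib P B)"
  shows "fib M A (Reidx P f \<alpha>) = Reidx R (ar M f) (fib M B \<alpha>)"
proof -
  have "f \<in> Hom P A B" using assms by (simp add: Hom_iff)
  then show ?thesis using is_arrow1 assms(4) unfolding is_arrow1_def by blast
qed

lemma prod_iso_props:
  assumes "A \<in> Obj P" "B \<in> Obj P"
  shows "prod_iso P R M A B \<in> Arr R" "Dom R (prod_iso P R M A B) = ob M A \<boxtimes>\<^bsub>R\<^esub> ob M B"
    "Cod R (prod_iso P R M A B) = ob M (A \<boxtimes>\<^bsub>P\<^esub> B)"
    "ar M (Pr1 P A B) \<cdot>\<^bsub>R\<^esub> prod_iso P R M A B = Pr1 R (ob M A) (ob M B)"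
    "ar M (Pr2 P A B) \<cdot>\<^bsub>R\<^esub> prod_iso P R M A B = Pr2 R (ob M A) (ob M B)"
  using R.mediate_props[OF ar_product[OF assms], of "Pr1 R (ob M A) (ob M B)" "Pr2 R (ob M A) (ob M B)"] assms
  by (simp_all add: prod_iso_def)

end

locale kleisli_extension = kleisli P X \<phi> + R: primary_doctrine R
  for P :: "('o, 'a, 'p) doctrine" and X :: 'o and \<phi> :: 'p and R :: "('u, 'b, 'q) doctrine" +
  fixes G :: "('o, 'a, 'p, 'u, 'b, 'q) arrow1"
    and G' :: "('o, 'o \<times> 'a \<times> 'o, 'p, 'u, 'b, 'q) arrow1"
  assumes G_arrow: "is_arrow1 P R G"
    and G'_primary: "primary_arrow (kleisli_doctrine P X \<phi>) R G'"
    and G'_extends: "eq_arrow1 P (comp_arrow1 G' (kleisli_arrow P X \<phi>)) G"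
begin

sublocale G: doctrine_arrow P R G
  by unfold_locales (rule G_arrow)

sublocale G': doctrine_arrow K R G'
  using G'_primary by unfold_locales (simp add: primary_arrow_def)

text \<open>When \<open>G'(id\<^sub>X) = c\<close>, this is the pairing of \<open>c\<close> with the identity of \<open>G A\<close>.\<close>

definition pair_c :: "'o \<Rightarrow> 'b" where
  "pair_c A = ar G' (A, Id P (Prod P X A), Prod P X A)"

lemma ob_eq [simp]: "A \<in> Obj P \<Longrightarrow> ob G' A = ob G A"
  using G'_extends by (simp add: eq_arrow1_def comp_arrow1_def)

lemma ar_eq:
  assumes "f \<in> Arr P" "Dom P f = A" "Cod P f = B"
  shows "ar G' (A, Comp P f (Pr2 P X A), B) = ar G f"
  using G'_extends assms by (auto simp add: eq_arrow1_def comp_arrow1_def)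

lemma fib_eq: "\<lbrakk>A \<in> Obj P; \<alpha> \<in> carrier (Fib P A)\<rbrakk> \<Longrightarrow> fib G' A (fib F A \<alpha>) = fib G A \<alpha>"
  using G'_extends by (simp add: eq_arrow1_def comp_arrow1_def)

lemma fib_top: "A \<in> Obj P \<Longrightarrow> fib G' A (weak_\<phi> A) = \<top>\<^bsub>Fib R (ob G A)\<^esub>"
  using G'_primary by (simp add: primary_arrow_def preserves_top_def)

text \<open>The projections of \<open>K\<close> are images of those of \<open>P\<close>, and
  \<open>G'\<close> sends them where \<open>G\<close> sends the originals; both isomorphisms
  therefore mediate between the same cones.\<close>

lemma prod_iso_eq:
  assumes "A \<in> Obj P" "B \<in> Obj P"
  shows "prod_iso K R G' A B = prod_iso P R G A B"
  using assms by (simp add: prod_iso_def ar_eq)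

lemma pair_c_typing [simp]:
  assumes "A \<in> Obj P"
  shows "pair_c A \<in> Arr R" "Dom R (pair_c A) = ob G A" "Cod R (pair_c A) = ob G (Prod P X A)"
  using assms by (simp_all add: pair_c_def)

text \<open>In \<open>K\<close>, the arrow \<open>\<eta>\<close> followed by the image of
  \<open>Pr2 P X A\<close> is the arrow \<open>Pr2 P X A\<close>, which is the Kleisli identity of
  \<open>A\<close>.\<close>

lemma Pr2_pair_c:
  assumes "A \<in> Obj P"
  shows "ar G (Pr2 P X A) \<cdot>\<^bsub>R\<^esub> pair_c A = Id R (ob G A)"
proof -
  let ?p = "Pr2 P X A"
  have "ar G ?p \<cdot>\<^bsub>R\<^esub> pair_c A = ar G' (Prod P X A, Comp P ?p (Pr2 P X (Prod P X A)), A) \<cdot>\<^bsub>R\<^esub> pair_c A"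
    using assms by (simp add: ar_eq)
  also have "\<dots> = ar G' (Comp K (Prod P X A, Comp P ?p (Pr2 P X (Prod P X A)), A) (A, Id P (Prod P X A), Prod P X A))"
    unfolding pair_c_def by (rule G'.ar_Comp[symmetric]) (use assms in simp_all)
  also have "\<dots> = ar G' (Id K A)"
    using assms by simp
  also have "\<dots> = Id R (ob G A)"
    using assms G'.ar_Id[of A] by simp
  finally show ?thesis .
qed

text \<open>The naturality square already commutes in \<open>K\<close>: both paths from
  \<open>A\<close> to \<open>X \<times> B\<close> have underlying arrow
  \<open>id \<times> f\<close>. Applying \<open>G'\<close> gives the claim.\<close>

lemma pair_c_natural:
  assumes f: "f \<in> Arr P" "Dom P f = A" "Cod P f = B"
  shows "pair_c B \<cdot>\<^bsub>R\<^esub> ar G f = ar G (tuple P (Pr1 P X A) (Comp P f (Pr2 P X A))) \<cdot>\<^bsub>R\<^esub> pair_c A"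
proof -
  have obj [simp]: "A \<in> Obj P" "B \<in> Obj P" using f by auto
  let ?h = "tuple P (Pr1 P X A) (Comp P f (Pr2 P X A))"
  let ?F = "\<lambda>f. (Dom P f, Comp P f (Pr2 P X (Dom P f)), Cod P f)"
  let ?e = "\<lambda>A. (A, Id P (Prod P X A), Prod P X A)"
  have "pair_c B \<cdot>\<^bsub>R\<^esub> ar G f = ar G' (?e B) \<cdot>\<^bsub>R\<^esub> ar G' (?F f)"
    using f by (simp add: pair_c_def ar_eq)
  also have "\<dots> = ar G' (Comp K (?e B) (?F f))"
    by (rule G'.ar_Comp[symmetric]) (use f in simp_all)
  also have "Comp K (?e B) (?F f) = Comp K (?F ?h) (?e A)"
    using f by simp
  also have "ar G' (Comp K (?F ?h) (?e A)) = ar G' (?F ?h) \<cdot>\<^bsub>R\<^esub> ar G' (?e A)"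
    by (rule G'.ar_Comp) (use f in simp_all)
  also have "ar G' (?F ?h) = ar G ?h"
    by (rule ar_eq) (use f in simp_all)
  also have "\<dots> \<cdot>\<^bsub>R\<^esub> ar G' (?e A) = \<dots> \<cdot>\<^bsub>R\<^esub> pair_c A"
    by (simp only: pair_c_def)
  finally show ?thesis .
qed

lemma fib_eq_Reidx_pair_c:
  assumes A: "A \<in> Obj P" and \<beta>: "\<beta> \<in> carrier (Fib K A)"
  shows "fib G' A \<beta> = Reidx R (pair_c A) (fib G (Prod P X A) \<beta>)"
proof -
  let ?XA = "Prod P X A"
  let ?e = "(A, Id P ?XA, ?XA)"
  interpret meet_top "Fib P ?XA" using A by (intro Fib_meet_top) simp
  have FK: "fib F ?XA \<beta> \<in> carrier (Fib K ?XA)"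
  proof -
    interpret meet_top "Fib P (Prod P X ?XA)" using A by (intro Fib_meet_top) simp
    show ?thesis using A \<beta> by (simp add: meet_left)
  qed
  \<comment> \<open>Reindexing along \<open>\<eta>\<close> returns \<open>\<beta>\<close> met with
    \<open>weak_\<phi> A\<close>, and membership in the Kleisli fiber makes this
    \<open>\<beta>\<close>.\<close>
  have "Reidx K ?e (fib F ?XA \<beta>) = \<beta>"
    using A \<beta> by (simp add: meet_absorb2)
  then have "fib G' A \<beta> = fib G' A (Reidx K ?e (fib F ?XA \<beta>))" by (simp only:)
  also have "\<dots> = Reidx R (pair_c A) (fib G' ?XA (fib F ?XA \<beta>))"
    unfolding pair_c_def by (rule G'.fib_Reidx) (use A FK in simp_all)
  also have "\<dots> = Reidx R (pair_c A) (fib G ?XA \<beta>)"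
    using A \<beta> by (subst fib_eq) simp_all
  finally show ?thesis .
qed

lemma Reidx_pair_c_top:
  assumes "A \<in> Obj P"
  shows "Reidx R (pair_c A) (fib G (Prod P X A) (weak_\<phi> A)) = \<top>\<^bsub>Fib R (ob G A)\<^esub>"
  using fib_eq_Reidx_pair_c[of A "weak_\<phi> A"] fib_top assms K.top_in_carrier[of A] by simp

text \<open>Removes the truncation of implications and universal quantifiers: after reindexing along
  \<open>pair_c A\<close> its factor has become the top.\<close>

lemma Reidx_pair_c_meet:
  assumes "primary_arrow P R G" and [simp]: "A \<in> Obj P" "\<alpha> \<in> carrier (Fib P (Prod P X A))"
  shows "Reidx R (pair_c A) (fib G (Prod P X A) (\<alpha> \<sqinter>\<^bsub>Fib P (Prod P X A)\<^esub> weak_\<phi> A))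
    = Reidx R (pair_c A) (fib G (Prod P X A) \<alpha>)"
proof -
  interpret meet_top "Fib R (ob G A)" by (intro R.Fib_meet_top) simp
  have "fib G (Prod P X A) (\<alpha> \<sqinter>\<^bsub>Fib P (Prod P X A)\<^esub> weak_\<phi> A)
      = fib G (Prod P X A) \<alpha> \<sqinter>\<^bsub>Fib R (ob G (Prod P X A))\<^esub> fib G (Prod P X A) (weak_\<phi> A)"
    using assms(1) by (simp add: primary_arrow_def preserves_meet_def)
  then show ?thesis
    by (simp add: Reidx_pair_c_top meet_absorb1)
qed

text \<open>Inserting \<open>c\<close> before \<open>C\<close> with \<open>B\<close> as a spectator
  is the same as inserting it before \<open>C \<times> B\<close>, once the product isomorphisms and
  the reassociation are made explicit. This is what lets a quantifier of \<open>R\<close> pass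
  through \<open>pair_c\<close>.\<close>

lemma pair_c_assoc:
  assumes [simp]: "C \<in> Obj P" "B \<in> Obj P"
  shows "ar G (assoc_inv X C B) \<cdot>\<^bsub>R\<^esub> prod_iso P R G (Prod P X C) B \<cdot>\<^bsub>R\<^esub> times_id R (pair_c C) (ob G B)
    = pair_c (Prod P C B) \<cdot>\<^bsub>R\<^esub> prod_iso P R G C B" (is "?l = ?r")
proof -
  let ?XC = "Prod P X C"
  let ?CB = "Prod P C B"
  let ?a = "ar G (assoc X C B)"
  let ?ai = "ar G (assoc_inv X C B)"
  note iso = G.prod_iso_props[of C B] G.prod_iso_props[of ?XC B]
  note iso_typing = iso(1,2,3,6,7,8)
  have [simp]: "prod_iso P R G C B \<in> Arr R" "Dom R (prod_iso P R G C B) = Prod R (ob G C) (ob G B)"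
    "Cod R (prod_iso P R G C B) = ob G ?CB"
    "prod_iso P R G ?XC B \<in> Arr R" "Dom R (prod_iso P R G ?XC B) = Prod R (ob G ?XC) (ob G B)"
    "Cod R (prod_iso P R G ?XC B) = ob G (Prod P ?XC B)"
    by (simp_all add: iso_typing)
  let ?w = "prod_iso P R G ?XC B \<cdot>\<^bsub>R\<^esub> times_id R (pair_c C) (ob G B)"
  \<comment> \<open>Cancels the image of \<open>assoc\<close> at the end, so that the comparison can
    be made on the other side of the reassociation.\<close>
  have inv: "?ai \<cdot>\<^bsub>R\<^esub> ?a \<cdot>\<^bsub>R\<^esub> k = k" if "k \<in> Arr R" "Cod R k = ob G (Prod P X ?CB)" for k
  proof -
    have "?ai \<cdot>\<^bsub>R\<^esub> ?a = Id R (ob G (Prod P X ?CB))"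
      by (simp add: G.ar_Id assoc_inverse flip: G.ar_Comp)
    then have "(?ai \<cdot>\<^bsub>R\<^esub> ?a) \<cdot>\<^bsub>R\<^esub> k = k"
      using that by (simp del: R.Comp_Comp)
    then show ?thesis
      using that by simp
  qed
  \<comment> \<open>After \<open>?a\<close> both composites end in the \<open>G\<close>-image of the
    product of \<open>X \<times> C\<close> with \<open>B\<close>, where the images of the two
    projections detect equality.\<close>
  have "?a \<cdot>\<^bsub>R\<^esub> ?r = ?w"
  proof (rule R.product_jointly_monic[OF G.ar_product[of ?XC B]])
    have "ar G (Pr1 P ?XC B) \<cdot>\<^bsub>R\<^esub> ?a \<cdot>\<^bsub>R\<^esub> ?r = (ar G (Pr1 P ?XC B) \<cdot>\<^bsub>R\<^esub> ?a) \<cdot>\<^bsub>R\<^esub> ?r"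
      by simp
    also have "ar G (Pr1 P ?XC B) \<cdot>\<^bsub>R\<^esub> ?a = ar G (tuple P (Pr1 P X ?CB) (Comp P (Pr1 P C B) (Pr2 P X ?CB)))"
      by (subst G.ar_Comp[symmetric]) (simp_all add: assoc_def)
    also have "\<dots> \<cdot>\<^bsub>R\<^esub> ?r = (\<dots> \<cdot>\<^bsub>R\<^esub> pair_c ?CB) \<cdot>\<^bsub>R\<^esub> prod_iso P R G C B"
      by (rule R.Comp_Comp[symmetric]) simp_all
    \<comment> \<open>Naturality along the projection from \<open>C \<times> B\<close> to
      \<open>C\<close> trades \<open>pair_c\<close> at \<open>C \<times> B\<close> for
      \<open>pair_c\<close> at \<open>C\<close>.\<close>
    also have "\<dots> = (pair_c C \<cdot>\<^bsub>R\<^esub> ar G (Pr1 P C B)) \<cdot>\<^bsub>R\<^esub> prod_iso P R G C B"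
      by (simp only: pair_c_natural[of "Pr1 P C B" ?CB C] Pr_typing assms)
    also have "\<dots> = pair_c C \<cdot>\<^bsub>R\<^esub> Pr1 R (ob G C) (ob G B)"
      by (simp add: iso)
    also have "\<dots> = Pr1 R (ob G ?XC) (ob G B) \<cdot>\<^bsub>R\<^esub> times_id R (pair_c C) (ob G B)"
      by (simp add: times_id_def)
    also have "\<dots> = ar G (Pr1 P ?XC B) \<cdot>\<^bsub>R\<^esub> ?w"
      by (subst iso(9)[symmetric]) simp_all
    finally show "ar G (Pr1 P ?XC B) \<cdot>\<^bsub>R\<^esub> ?a \<cdot>\<^bsub>R\<^esub> ?r = ar G (Pr1 P ?XC B) \<cdot>\<^bsub>R\<^esub> ?w" .
    have "ar G (Pr2 P ?XC B) \<cdot>\<^bsub>R\<^esub> ?a \<cdot>\<^bsub>R\<^esub> ?r = (ar G (Pr2 P ?XC B) \<cdot>\<^bsub>R\<^esub> ?a) \<cdot>\<^bsub>R\<^esub> ?r"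
      by simp
    also have "ar G (Pr2 P ?XC B) \<cdot>\<^bsub>R\<^esub> ?a = ar G (Pr2 P C B) \<cdot>\<^bsub>R\<^esub> ar G (Pr2 P X ?CB)"
      by (subst (1 2) G.ar_Comp[symmetric]) (simp_all add: assoc_def)
    also have "\<dots> \<cdot>\<^bsub>R\<^esub> ?r = ar G (Pr2 P C B) \<cdot>\<^bsub>R\<^esub> (ar G (Pr2 P X ?CB) \<cdot>\<^bsub>R\<^esub> pair_c ?CB) \<cdot>\<^bsub>R\<^esub> prod_iso P R G C B"
      by simp
    also have "\<dots> = Pr2 R (ob G C) (ob G B)"
      by (subst Pr2_pair_c) (simp_all add: iso)
    also have "\<dots> = Pr2 R (ob G ?XC) (ob G B) \<cdot>\<^bsub>R\<^esub> times_id R (pair_c C) (ob G B)"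
      by (simp add: times_id_def)
    also have "\<dots> = ar G (Pr2 P ?XC B) \<cdot>\<^bsub>R\<^esub> ?w"
      by (subst iso(10)[symmetric]) simp_all
    finally show "ar G (Pr2 P ?XC B) \<cdot>\<^bsub>R\<^esub> ?a \<cdot>\<^bsub>R\<^esub> ?r = ar G (Pr2 P ?XC B) \<cdot>\<^bsub>R\<^esub> ?w" .
  qed simp_all
  then have "?ai \<cdot>\<^bsub>R\<^esub> ?w = ?ai \<cdot>\<^bsub>R\<^esub> ?a \<cdot>\<^bsub>R\<^esub> ?r" by (simp only:)
  also have "\<dots> = ?r" by (rule inv) simp_all
  finally show ?thesis .
qed

text \<open>Here \<open>E\<close> and \<open>E'\<close> stand for the existential or for the universal quantifiers.\<close>

lemma fib_quantifier:
  assumes BC: "\<And>B C C' f \<alpha>. \<lbrakk>B \<in> Obj R; f \<in> Arr R; Dom R f = C; Cod R f = C'; \<alpha> \<in> carrier (Fib R (Prod R C' B))\<rbrakk>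
      \<Longrightarrow> Reidx R f (E' B C' \<alpha>) = E' B C (Reidx R (times_id R f B) \<alpha>)"
    and G: "\<And>B C \<alpha>. \<lbrakk>B \<in> Obj P; C \<in> Obj P; \<alpha> \<in> carrier (Fib P (Prod P C B))\<rbrakk> \<Longrightarrow> fib G C (E B C \<alpha>)
      = E' (ob G B) (ob G C) (Reidx R (prod_iso P R G C B) (fib G (Prod P C B) \<alpha>))"
    and [simp]: "B \<in> Obj P" "C \<in> Obj P" "\<alpha> \<in> carrier (Fib P (Prod P X (Prod P C B)))"
  shows "Reidx R (pair_c C) (fib G (Prod P X C) (E B (Prod P X C) (Reidx P (assoc_inv X C B) \<alpha>)))
    = E' (ob G B) (ob G C) (Reidx R (prod_iso P R G C B)
        (Reidx R (pair_c (Prod P C B)) (fib G (Prod P X (Prod P C B)) \<alpha>)))"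
proof -
  note [simp] = G.prod_iso_props(1-3)
  let ?XC = "Prod P X C"
  let ?g = "fib G (Prod P X (Prod P C B)) \<alpha>"
  have "fib G ?XC (E B ?XC (Reidx P (assoc_inv X C B) \<alpha>))
      = E' (ob G B) (ob G ?XC) (Reidx R (prod_iso P R G ?XC B)
          (fib G (Prod P ?XC B) (Reidx P (assoc_inv X C B) \<alpha>)))"
    by (rule G) simp_all
  also have "fib G (Prod P ?XC B) (Reidx P (assoc_inv X C B) \<alpha>) = Reidx R (ar G (assoc_inv X C B)) ?g"
    by (rule G.fib_Reidx) simp_all
  \<comment> \<open>Beck--Chevalley in \<open>R\<close> along \<open>pair_c C\<close> moves the
    reindexing under the quantifier, where it acts as \<open>pair_c C\<close> times the
    identity.\<close>
  also have "Reidx R (pair_c C) (E' (ob G B) (ob G ?XC) (Reidx R (prod_iso P R G ?XC B) \<dots>))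
      = E' (ob G B) (ob G C) (Reidx R (times_id R (pair_c C) (ob G B)) (Reidx R (prod_iso P R G ?XC B) \<dots>))"
    by (rule BC) simp_all
  also have "Reidx R (times_id R (pair_c C) (ob G B)) (Reidx R (prod_iso P R G ?XC B)
        (Reidx R (ar G (assoc_inv X C B)) ?g))
      = Reidx R (ar G (assoc_inv X C B) \<cdot>\<^bsub>R\<^esub> prod_iso P R G ?XC B \<cdot>\<^bsub>R\<^esub> times_id R (pair_c C) (ob G B)) ?g"
    by simp
  also have "\<dots> = Reidx R (prod_iso P R G C B) (Reidx R (pair_c (Prod P C B)) ?g)"
    by (subst pair_c_assoc) simp_all
  finally show ?thesis .
qed

section \<open>Preservation of each structure by the extension \<open>G'\<close>\<close>

lemma elementary_extension:
  assumes "elementary_arrow P R G"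
  shows "elementary_arrow K R G'"
  unfolding elementary_arrow_def
proof (intro conjI allI impI ballI)
  show "elementary K" "elementary R"
    using assms kleisli_elementary by (auto simp: elementary_arrow_def)
  show "is_arrow1 K R G'" by (rule G'.is_arrow1)
  obtain \<delta> where \<delta>: "fibered_equality P \<delta>"
    using assms by (auto simp: elementary_arrow_def elementary_def)
  fix \<delta>' \<epsilon> A
  assume \<delta>': "fibered_equality K \<delta>'" and \<epsilon>: "fibered_equality R \<epsilon>" and "A \<in> Obj K"
  then have A [simp]: "A \<in> Obj P" by simp
  \<comment> \<open>Uniqueness replaces the arbitrary Kleisli equality by the image of that of
    \<open>P\<close>, on which \<open>G'\<close> is known.\<close>
  have "\<delta>' A = fib F (Prod P A A) (\<delta> A)"
    by (rule K.fibered_equality_unique[OF \<delta>' kleisli_fibered_equality[OF \<delta>]]) simp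
  moreover have "fib G' (Prod P A A) (fib F (Prod P A A) (\<delta> A)) = fib G (Prod P A A) (\<delta> A)"
    using \<delta> by (intro fib_eq) (simp_all add: fibered_equality_def)
  moreover have "Reidx R (prod_iso P R G A A) (fib G (Prod P A A) (\<delta> A)) = \<epsilon> (ob G A)"
    using assms \<delta> \<epsilon> A unfolding elementary_arrow_def by blast
  ultimately show "Reidx R (prod_iso K R G' A A) (fib G' (Prod K A A) (\<delta>' A)) = \<epsilon> (ob G' A)"
    by (simp only: kleisli_simps(6) prod_iso_eq ob_eq A)
qed

lemma existential_extension:
  assumes G_ex: "existential_arrow P R G"
  shows "existential_arrow K R G'"
  unfolding existential_arrow_def
proof (intro conjI allI impI ballI)
  show "existential K" "existential R"
    using assms kleisli_existential by (auto simp: existential_arrow_def)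
  show "is_arrow1 K R G'" by (rule G'.is_arrow1)
  obtain E where E: "existential_quantifier P E"
    using assms by (auto simp: existential_arrow_def existential_def)
  fix E\<^sub>K E' B C \<alpha>
  assume E\<^sub>K: "existential_quantifier K E\<^sub>K" and E': "existential_quantifier R E'"
    and "B \<in> Obj K" "C \<in> Obj K" and \<alpha>: "\<alpha> \<in> carrier (Fib K (Prod K C B))"
  then have [simp]: "B \<in> Obj P" "C \<in> Obj P" "\<alpha> \<in> carrier (Fib P (Prod P X (Prod P C B)))" by simp_all
  let ?\<gamma> = "E B (Prod P X C) (Reidx P (assoc_inv X C B) \<alpha>)"
  have E\<^sub>K_eq: "E\<^sub>K B C \<alpha> = ?\<gamma>"
    by (rule K.existential_quantifier_unique[OF E\<^sub>K kleisli_existential_quantifier[OF E]])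
      (use \<alpha> in simp_all)
  have "fib G' C (E\<^sub>K B C \<alpha>) = Reidx R (pair_c C) (fib G (Prod P X C) (E\<^sub>K B C \<alpha>))"
    by (rule fib_eq_Reidx_pair_c[OF _ K.existential_quantifier_closed[OF E\<^sub>K]]) (use \<alpha> in simp_all)
  also have "\<dots> = E' (ob G B) (ob G C) (Reidx R (prod_iso P R G C B)
      (Reidx R (pair_c (Prod P C B)) (fib G (Prod P X (Prod P C B)) \<alpha>)))"
    unfolding E\<^sub>K_eq
  proof (rule fib_quantifier)
    show "fib G C (E B C \<alpha>) = E' (ob G B) (ob G C) (Reidx R (prod_iso P R G C B) (fib G (Prod P C B) \<alpha>))"
      if "B \<in> Obj P" "C \<in> Obj P" "\<alpha> \<in> carrier (Fib P (Prod P C B))" for B C \<alpha>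
      using G_ex E E' that unfolding existential_arrow_def by blast
  qed (simp_all add: R.existential_quantifier_Reidx[OF E'])
  also have "Reidx R (pair_c (Prod P C B)) (fib G (Prod P X (Prod P C B)) \<alpha>) = fib G' (Prod P C B) \<alpha>"
    using \<alpha> by (intro fib_eq_Reidx_pair_c[symmetric]) simp_all
  finally show "fib G' C (E\<^sub>K B C \<alpha>)
      = E' (ob G' B) (ob G' C) (Reidx R (prod_iso K R G' C B) (fib G' (Prod K C B) \<alpha>))"
    by (simp add: prod_iso_eq)
qed

text \<open>The assumption \<open>G_prim\<close> is separate because \<open>universal_arrow\<close>
  says nothing about meets, and the truncation of the Kleisli quantifier has to be moved through
  \<open>fib G\<close>.\<close>

lemma universal_extension:
  assumes G_un: "universal_arrow P R G"
    and G_prim: "primary_arrow P R G"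
  shows "universal_arrow K R G'"
  unfolding universal_arrow_def
proof (intro conjI allI impI ballI)
  show "universal K" "universal R"
    using assms kleisli_universal by (auto simp: universal_arrow_def)
  show "is_arrow1 K R G'" by (rule G'.is_arrow1)
  obtain U where U: "universal_quantifier P U"
    using assms by (auto simp: universal_arrow_def universal_def)
  fix U\<^sub>K U' B C \<alpha>
  assume U\<^sub>K: "universal_quantifier K U\<^sub>K" and U': "universal_quantifier R U'"
    and "B \<in> Obj K" "C \<in> Obj K" and \<alpha>: "\<alpha> \<in> carrier (Fib K (Prod K C B))"
  then have [simp]: "B \<in> Obj P" "C \<in> Obj P" "\<alpha> \<in> carrier (Fib P (Prod P X (Prod P C B)))" by simp_all
  let ?XC = "Prod P X C"
  let ?\<gamma> = "U B ?XC (Reidx P (assoc_inv X C B) \<alpha>)"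
  have \<gamma> [simp]: "?\<gamma> \<in> carrier (Fib P ?XC)"
    by (rule universal_quantifier_closed[OF U]) simp_all
  have U\<^sub>K_eq: "U\<^sub>K B C \<alpha> = ?\<gamma> \<sqinter>\<^bsub>Fib P ?XC\<^esub> weak_\<phi> C"
    by (rule K.universal_quantifier_unique[OF U\<^sub>K kleisli_universal_quantifier[OF U]])
      (use \<alpha> in simp_all)
  have "fib G' C (U\<^sub>K B C \<alpha>) = Reidx R (pair_c C) (fib G ?XC (U\<^sub>K B C \<alpha>))"
    by (rule fib_eq_Reidx_pair_c[OF _ K.universal_quantifier_closed[OF U\<^sub>K]]) (use \<alpha> in simp_all)
  also have "\<dots> = Reidx R (pair_c C) (fib G ?XC ?\<gamma>)"
    unfolding U\<^sub>K_eq by (rule Reidx_pair_c_meet[OF G_prim]) simp_all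
  also have "\<dots> = U' (ob G B) (ob G C) (Reidx R (prod_iso P R G C B)
      (Reidx R (pair_c (Prod P C B)) (fib G (Prod P X (Prod P C B)) \<alpha>)))"
  proof (rule fib_quantifier)
    show "fib G C (U B C \<alpha>) = U' (ob G B) (ob G C) (Reidx R (prod_iso P R G C B) (fib G (Prod P C B) \<alpha>))"
      if "B \<in> Obj P" "C \<in> Obj P" "\<alpha> \<in> carrier (Fib P (Prod P C B))" for B C \<alpha>
      using G_un U U' that unfolding universal_arrow_def by blast
  qed (simp_all add: R.universal_quantifier_Reidx[OF U'])
  also have "Reidx R (pair_c (Prod P C B)) (fib G (Prod P X (Prod P C B)) \<alpha>) = fib G' (Prod P C B) \<alpha>"
    using \<alpha> by (intro fib_eq_Reidx_pair_c[symmetric]) simp_all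
  finally show "fib G' C (U\<^sub>K B C \<alpha>)
      = U' (ob G' B) (ob G' C) (Reidx R (prod_iso K R G' C B) (fib G' (Prod K C B) \<alpha>))"
    by (simp add: prod_iso_eq)
qed

lemma pair_c_Hom: "A \<in> Obj P \<Longrightarrow> pair_c A \<in> Hom R (ob G A) (ob G (Prod P X A))"
  by (simp add: Hom_iff)

lemma implicational_extension:
  assumes G_imp: "implicational_arrow P R G"
  shows "implicational_arrow K R G'"
  unfolding implicational_arrow_def
proof (intro conjI ballI)
  show "implicational K" "implicational R"
    using assms kleisli_implicational by (auto simp: implicational_arrow_def)
  show "primary_arrow K R G'" by (rule G'_primary)
  fix A assume "A \<in> Obj K"
  then have A [simp]: "A \<in> Obj P" by simp
  let ?XA = "Prod P X A"
  have cc: "cartesian_closed_poset (Fib P ?XA)"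
    using G_imp by (simp add: implicational_arrow_def implicational_def)
  have e_imp: "preserves_imp (Fib R (ob G ?XA)) (Fib R (ob G A)) (Reidx R (pair_c A))"
    using G_imp pair_c_Hom[OF A] unfolding implicational_arrow_def implicational_def by blast
  have G_imp': "preserves_imp (Fib P ?XA) (Fib R (ob G ?XA)) (fib G ?XA)"
    using G_imp by (simp add: implicational_arrow_def)
  show "preserves_imp (Fib K A) (Fib R (ob G' A)) (fib G' A)"
    unfolding preserves_imp_def
  proof (intro ballI)
    fix x y assume x: "x \<in> carrier (Fib K A)" and y: "y \<in> carrier (Fib K A)"
    then have [simp]: "x \<in> carrier (Fib P ?XA)" "y \<in> carrier (Fib P ?XA)" by simp_all
    have "cartesian_closed_poset (Fib K A)"
      by (simp add: down_cartesian_closed(1)[OF cc])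
    then have "fib G' A (imp (Fib K A) x y) = Reidx R (pair_c A) (fib G ?XA (imp (Fib K A) x y))"
      using x y by (intro fib_eq_Reidx_pair_c imp_closed A)
    also have "\<dots> = Reidx R (pair_c A) (fib G ?XA (imp (Fib P ?XA) x y \<sqinter>\<^bsub>Fib P ?XA\<^esub> weak_\<phi> A))"
      using x y by (simp add: down_cartesian_closed(2)[OF cc])
    also have "\<dots> = Reidx R (pair_c A) (fib G ?XA (imp (Fib P ?XA) x y))"
      using G_imp by (intro Reidx_pair_c_meet) (simp_all add: implicational_arrow_def imp_closed[OF cc])
    also have "\<dots> = imp (Fib R (ob G A)) (Reidx R (pair_c A) (fib G ?XA x)) (Reidx R (pair_c A) (fib G ?XA y))"
      using e_imp G_imp' by (simp add: preserves_imp_def)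
    also have "\<dots> = imp (Fib R (ob G' A)) (fib G' A x) (fib G' A y)"
      using x y by (simp add: fib_eq_Reidx_pair_c)
    finally show "fib G' A (imp (Fib K A) x y) = imp (Fib R (ob G' A)) (fib G' A x) (fib G' A y)" .
  qed
qed

lemma bounded_extension:
  assumes G_bd: "bounded_arrow P R G"
  shows "bounded_arrow K R G'"
  unfolding bounded_arrow_def
proof (intro conjI ballI)
  show "bounded_doctrine K" "bounded_doctrine R"
    using assms kleisli_bounded by (auto simp: bounded_arrow_def)
  show "is_arrow1 K R G'" by (rule G'.is_arrow1)
  fix A assume "A \<in> Obj K"
  then have A [simp]: "A \<in> Obj P" by simp
  let ?XA = "Prod P X A"
  show "preserves_top (Fib K A) (Fib R (ob G' A)) (fib G' A)"
    using G'_primary by (simp add: primary_arrow_def)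
  have bot: "weak_partial_order_bottom (Fib P ?XA)"
    using G_bd by (simp add: bounded_arrow_def bounded_doctrine_def)
  have e_bot: "preserves_bottom (Fib R (ob G ?XA)) (Fib R (ob G A)) (Reidx R (pair_c A))"
    using G_bd pair_c_Hom[OF A] unfolding bounded_arrow_def bounded_doctrine_def by blast
  have G_bot: "preserves_bottom (Fib P ?XA) (Fib R (ob G ?XA)) (fib G ?XA)"
    using G_bd by (simp add: bounded_arrow_def)
  note K_bot = meet_top.down_bottom[OF Fib_meet_top bot, of "weak_\<phi> A"]
  have "\<bottom>\<^bsub>Fib K A\<^esub> \<in> carrier (Fib K A)"
    by (rule weak_partial_order_bottom.bottom_closed) (simp add: K_bot(1))
  then have "fib G' A \<bottom>\<^bsub>Fib K A\<^esub> = Reidx R (pair_c A) (fib G ?XA \<bottom>\<^bsub>Fib K A\<^esub>)"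
    by (rule fib_eq_Reidx_pair_c[OF A])
  then show "preserves_bottom (Fib K A) (Fib R (ob G' A)) (fib G' A)"
    using e_bot G_bot by (simp add: preserves_bottom_def K_bot(2))
qed

lemma join_extension:
  assumes G_join: "join_arrow P R G"
  shows "join_arrow K R G'"
  unfolding join_arrow_def
proof (intro conjI ballI)
  show "has_binary_joins K" "has_binary_joins R"
    using assms kleisli_joins by (auto simp: join_arrow_def)
  then have K_up: "upper_semilattice (Fib K A)" if "A \<in> Obj K" for A
    using that unfolding has_binary_joins_def by blast
  show "is_arrow1 K R G'" by (rule G'.is_arrow1)
  fix A assume "A \<in> Obj K"
  then have A [simp]: "A \<in> Obj P" by simp
  let ?XA = "Prod P X A"
  have up: "upper_semilattice (Fib P ?XA)"
    using G_join by (simp add: join_arrow_def has_binary_joins_def)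
  have e_join: "preserves_join (Fib R (ob G ?XA)) (Fib R (ob G A)) (Reidx R (pair_c A))"
    using G_join pair_c_Hom[OF A] unfolding join_arrow_def has_binary_joins_def by blast
  have G_join': "preserves_join (Fib P ?XA) (Fib R (ob G ?XA)) (fib G ?XA)"
    using G_join by (simp add: join_arrow_def)
  show "preserves_join (Fib K A) (Fib R (ob G' A)) (fib G' A)"
    unfolding preserves_join_def
  proof (intro ballI)
    fix x y assume x: "x \<in> carrier (Fib K A)" and y: "y \<in> carrier (Fib K A)"
    interpret J: upper_semilattice "Fib K A" by (rule K_up) simp
    have "fib G' A (x \<squnion>\<^bsub>Fib K A\<^esub> y) = Reidx R (pair_c A) (fib G ?XA (x \<squnion>\<^bsub>Fib K A\<^esub> y))"
      by (intro fib_eq_Reidx_pair_c J.join_closed A x y)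
    also have "\<dots> = Reidx R (pair_c A) (fib G ?XA (x \<squnion>\<^bsub>Fib P ?XA\<^esub> y))"
      using x y by (simp add: meet_top.down_join(2)[OF Fib_meet_top up])
    also have "\<dots> = Reidx R (pair_c A) (fib G ?XA x) \<squnion>\<^bsub>Fib R (ob G A)\<^esub> Reidx R (pair_c A) (fib G ?XA y)"
      using e_join G_join' x y by (simp add: preserves_join_def)
    also have "\<dots> = fib G' A x \<squnion>\<^bsub>Fib R (ob G' A)\<^esub> fib G' A y"
      using x y by (simp add: fib_eq_Reidx_pair_c)
    finally show "fib G' A (x \<squnion>\<^bsub>Fib K A\<^esub> y) = fib G' A x \<squnion>\<^bsub>Fib R (ob G' A)\<^esub> fib G' A y" .
  qed
qed

lemma heyting_extension: "heyting_arrow P R G \<Longrightarrow> heyting_arrow K R G'"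
  unfolding heyting_arrow_iff
  by (simp add: implicational_extension bounded_extension join_extension)

lemma boolean_extension: "boolean_arrow P R G \<Longrightarrow> boolean_arrow K R G'"
  unfolding boolean_arrow_def by (simp add: kleisli_boolean heyting_extension)

end


theorem theorem6p3:
  fixes P :: "('o, 'a, 'p) doctrine"
    and R :: "('u, 'b, 'q) doctrine"
    and G :: "('o, 'a, 'p, 'u, 'b, 'q) arrow1"
    and G' :: "('o, 'o \<times> 'a \<times> 'o, 'p, 'u, 'b, 'q) arrow1"
    and X :: 'o and \<phi> :: 'p and c :: 'b
  assumes "primary P" and "primary R"
    and "X \<in> Obj P" and "\<phi> \<in> carrier (Fib P X)"
    and "primary_arrow P R G"
    and "c \<in> Hom R (Term R) (ob G X)"
    and "\<top>\<^bsub>Fib R (Term R)\<^esub> \<sqsubseteq>\<^bsub>Fib R (Term R)\<^esub> Reidx R c (fib G X \<phi>)"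
    and "primary_arrow (kleisli_doctrine P X \<phi>) R G'"
    and "eq_arrow1 P (comp_arrow1 G' (kleisli_arrow P X \<phi>)) G"
    and "ar G' (kleisli_point P X) \<cdot>\<^bsub>R\<^esub> bang R (Term R) (ob G' (Term P)) = c"
  shows "(elementary_arrow P R G \<longrightarrow> elementary_arrow (kleisli_doctrine P X \<phi>) R G')
    \<and> (existential_arrow P R G \<longrightarrow> existential_arrow (kleisli_doctrine P X \<phi>) R G')
    \<and> (universal_arrow P R G \<longrightarrow> universal_arrow (kleisli_doctrine P X \<phi>) R G')
    \<and> (implicational_arrow P R G \<longrightarrow> implicational_arrow (kleisli_doctrine P X \<phi>) R G')
    \<and> (bounded_arrow P R G \<longrightarrow> bounded_arrow (kleisli_doctrine P X \<phi>) R G')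
    \<and> (join_arrow P R G \<longrightarrow> join_arrow (kleisli_doctrine P X \<phi>) R G')
    \<and> (heyting_arrow P R G \<longrightarrow> heyting_arrow (kleisli_doctrine P X \<phi>) R G')
    \<and> (boolean_arrow P R G \<longrightarrow> boolean_arrow (kleisli_doctrine P X \<phi>) R G')"
proof -
  \<comment> \<open>Primariness of the Kleisli doctrine is read off from the hypothesis that
    \<open>G'\<close> is a primary 1-arrow out of it.\<close>
  have "primary_doctrine P" "primary_doctrine R" "primary_doctrine (kleisli_doctrine P X \<phi>)"
      "is_arrow1 P R G"
    using assms(1,2,5,8) by (simp_all only: primary_arrow_def primary_iff)
  then interpret kleisli_extension P X \<phi> R G G'
    using assms(3,4,8,9) by (simp only: kleisli_extension_def kleisli_extension_axioms_def
        kleisli_def kleisli_axioms_def)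
  show ?thesis
    using assms(5) elementary_extension existential_extension universal_extension
      implicational_extension bounded_extension join_extension heyting_extension boolean_extension
    by blast
qed

end
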